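(* Let $\Omega_c$ be the maximal (with respect to inclusion) Cheeger set of $\Omega\setminus\Omega_s$, and let $\lambda_c := \frac{\operatorname{Per}(\Omega_c)}{|\Omega_c|}$ be the Cheeger constant of $\Omega\setminus\Omega_s$. Let $\Omega_{1c}$ be the minimal (with respect to inclusion) minimizer of $$E \mapsto \operatorname{Per}(E) + \lambda_c |E|$$ among measurable sets $E$ with $\Omega_s \subset E \subset \Omega$. Then the pair $(\Omega_{1c},\Omega_c)$ minimizes $\mathcal S$ in $M$.
   Context: $\Omega\subset\mathbb{R}^2$ is a bounded domain (of finite perimeter) and $\Omega_s\subset\Omega$ is a measurable set of finite perimeter with $|\Omega_s|>0$ and $|\Omega\setminus\Omega_s|>0$. $|E|$ is Lebesgue measure in $\mathbb{R}^2$; $\operatorname{Per}(E)=TV(1_E)=|D1_E|(\mathbb{R}^2)$ is the perimeter in all of $\mathbb{R}^2$ ($+\infty$ if $1_E\notin BV(\mathbb{R}^2)$). Sets are identified when they differ by a Lebesgue-null set; inclusion and disjointness are understood up to null sets. A Cheeger set of a set $\Omega_0$ of finite perimeter is a set $E_0\subset\Omega_0$ minimizing $\operatorname{Per}(E)/|E|$ among subsets $E$ of $\Omega_0$ with $|E|>0$; the minimal value is the Cheeger constant of $\Omega_0$. Cheeger sets are stable under union, so there is a unique maximal one with respect to inclusion. $M := \{(E_1,E_-) : E_1,E_-\subset\Omega \text{ measurable},\ |E_1\cap E_-|=0,\ \Omega_s\subset E_1\}$, and $$\mathcal S(E_1,E_-) := \operatorname{Per}(E_1)+\frac{|E_1|}{|E_-|}\operatorname{Per}(E_-),$$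 with $\mathcal S(E_1,E_-)=+\infty$ if $|E_-|=0$. *)

theory Defs
  imports "HOL-Analysis.Analysis"
begin

subsection \<open>Total variation and perimeter\<close>

definition divergence :: "('a::euclidean_space \<Rightarrow> 'a) \<Rightarrow> 'a \<Rightarrow> real" where
  "divergence \<phi> x = (\<Sum>b\<in>Basis. frechet_derivative \<phi> (at x) b \<bullet> b)"

text \<open>Fields of class \<open>C\<^sup>1\<close> with compact support and Euclidean norm at most 1 everywhere. In finite
  dimension, continuity of all directional derivatives amounts to continuity of the derivative in
  operator norm.\<close>

definition test_fields :: "('a::euclidean_space \<Rightarrow> 'a) set" where
  "test_fields = {\<phi>. (\<forall>x. \<phi> differentiable (at x)) \<and>
     (\<forall>v. continuous_on UNIV (\<lambda>x. frechet_derivative \<phi> (at x) v)) \<and>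
     compact (closure {x. \<phi> x \<noteq> 0}) \<and> (\<forall>x. norm (\<phi> x) \<le> 1)}"

text \<open>The total variation \<open>|Du|(\<real>\<^sup>n)\<close>, meaningful for locally integrable \<open>u\<close>. Truncating
  negative integrals to 0 does not affect the supremum, as \<open>\<phi> = 0\<close> is a test field.\<close>

definition TV :: "('a::euclidean_space \<Rightarrow> real) \<Rightarrow> ennreal" where
  "TV u = (SUP \<phi>\<in>test_fields. ennreal (LINT x|lebesgue. u x * divergence \<phi> x))"

definition BV :: "('a::euclidean_space \<Rightarrow> real) set" where
  "BV = {u. integrable lebesgue u \<and> TV u < \<infinity>}"

definition Per :: "'a::euclidean_space set \<Rightarrow> ennreal" where
  "Per E = (if indicat_real E \<in> BV then TV (indicat_real E) else \<infinity>)"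

subsection \<open>Inclusion up to Lebesgue-null sets\<close>

definition ae_subset :: "'a::euclidean_space set \<Rightarrow> 'a set \<Rightarrow> bool" (infix "\<subseteq>\<^sub>0" 50) where
  "A \<subseteq>\<^sub>0 B \<longleftrightarrow> A - B \<in> null_sets lebesgue"

text \<open>Maximality and minimality are the order-theoretic notions (no strictly larger, respectively
  smaller, set with the property, where sets differing by a null set are identified). In
  particular, the greatest and the least such set, if they exist, are covered.\<close>

definition ae_maximal :: "('a::euclidean_space set \<Rightarrow> bool) \<Rightarrow> 'a set \<Rightarrow> bool" where
  "ae_maximal P A \<longleftrightarrow> P A \<and> (\<forall>B. P B \<longrightarrow> A \<subseteq>\<^sub>0 B \<longrightarrow> B \<subseteq>\<^sub>0 A)"

definition ae_minimal :: "('a::euclidean_space set \<Rightarrow> bool) \<Rightarrow> 'a set \<Rightarrow> bool" where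
  "ae_minimal P A \<longleftrightarrow> P A \<and> (\<forall>B. P B \<longrightarrow> B \<subseteq>\<^sub>0 A \<longrightarrow> A \<subseteq>\<^sub>0 B)"

subsection \<open>Cheeger sets and the functional\<close>

definition cheeger_ratio :: "'a::euclidean_space set \<Rightarrow> ennreal" where
  "cheeger_ratio E = Per E / emeasure lebesgue E"

definition is_cheeger_set :: "'a::euclidean_space set \<Rightarrow> 'a set \<Rightarrow> bool" where
  "is_cheeger_set \<Omega>\<^sub>0 = is_arg_min cheeger_ratio
     (\<lambda>E. E \<in> sets lebesgue \<and> E \<subseteq>\<^sub>0 \<Omega>\<^sub>0 \<and> emeasure lebesgue E > 0)"

definition admissible_pairs ::
    "'a::euclidean_space set \<Rightarrow> 'a set \<Rightarrow> ('a set \<times> 'a set) set" where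
  "admissible_pairs \<Omega> \<Omega>\<^sub>s = {(E\<^sub>1, E\<^sub>m). E\<^sub>1 \<in> sets lebesgue \<and> E\<^sub>m \<in> sets lebesgue \<and>
     E\<^sub>1 \<subseteq>\<^sub>0 \<Omega> \<and> E\<^sub>m \<subseteq>\<^sub>0 \<Omega> \<and> emeasure lebesgue (E\<^sub>1 \<inter> E\<^sub>m) = 0 \<and> \<Omega>\<^sub>s \<subseteq>\<^sub>0 E\<^sub>1}"

text \<open>The case distinction is needed because \<open>0 / 0 = 0\<close> and \<open>\<infinity> * 0 = 0\<close> in the extended
  non-negative reals.\<close>

definition S_functional :: "'a::euclidean_space set \<times> 'a set \<Rightarrow> ennreal" where
  "S_functional = (\<lambda>(E\<^sub>1, E\<^sub>m). if emeasure lebesgue E\<^sub>m = 0 then \<infinity>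
     else Per E\<^sub>1 + emeasure lebesgue E\<^sub>1 / emeasure lebesgue E\<^sub>m * Per E\<^sub>m)"

end

theory Submission imports Defs begin

text \<open>If \<open>(E\<^sub>1, E\<^sub>m)\<close> is admissible, then \<open>E\<^sub>m\<close> lies in \<open>\<Omega> - \<Omega>\<^sub>s\<close>, so \<open>Per E\<^sub>m / |E\<^sub>m| \<ge> \<lambda>\<^sub>c\<close> and
  the functional is at least \<open>Per E\<^sub>1 + \<lambda>\<^sub>c |E\<^sub>1|\<close>, which \<open>\<Omega>\<^sub>1\<^sub>c\<close> minimizes. The point is that the pair
  \<open>(A, B) = (\<Omega>\<^sub>1\<^sub>c, \<Omega>\<^sub>c)\<close> is itself admissible, that is, \<open>|A \<inter> B| = 0\<close>. By
  \<open>Per (A - B) + Per (B - A) \<le> Per A + Per B\<close> and \<open>Per (B - A) \<ge> \<lambda>\<^sub>c |B - A|\<close>, the set \<open>A - B\<close> has at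
  most the energy of \<open>A\<close>, and minimality of \<open>A\<close> applies. The perimeter inequality is the case
  \<open>w = 1\<^sub>A - 1\<^sub>B\<close> of \<open>TV w\<^sup>+ + TV w\<^sup>- \<le> TV w\<close>. For the latter, \<open>w\<close> is approximated by mollifications \<open>g\<close>;
  since test fields can be translated, \<open>\<integral> g div \<theta> \<le> TV w\<close> for all of them, and for smooth \<open>g\<close> two test
  fields for \<open>g\<^sup>+\<close> and \<open>g\<^sup>-\<close> can be glued, with a weight depending on \<open>g\<close>, into one test field for
  \<open>g\<close>.\<close>

subsection \<open>Continuity of translations in the mean\<close>

lemma
  fixes f :: "'a::euclidean_space \<Rightarrow> real"
  shows integrable_translate: "integrable lborel f \<Longrightarrow> integrable lborel (\<lambda>x. f (x + y))"
    and integral_translate: "f \<in> borel_measurable borel \<Longrightarrow> (LINT x|lborel. f (x + y)) = (LINT x|lborel. f x)"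
proof -
  have *: "distr lborel lborel (\<lambda>x. x + y) = lborel"
    using lborel_distr_plus[of y] by (subst distr_cong[OF refl sets_lborel, of _ _ "(+) y"]) (auto simp: add.commute)
  show "integrable lborel f \<Longrightarrow> integrable lborel (\<lambda>x. f (x + y))"
    using integrable_distr[of "\<lambda>x. x + y" lborel lborel f] * by simp
  show "(LINT x|lborel. f (x + y)) = (LINT x|lborel. f x)" if "f \<in> borel_measurable borel"
    using integral_distr[of "\<lambda>x. x + y" lborel lborel f] * that by simp
qed

lemma
  fixes f :: "'a::euclidean_space \<Rightarrow> real"
  shows integrable_translate_diff: "integrable lborel f \<Longrightarrow> integrable lborel (\<lambda>x. f (x - y))"
    and integral_translate_diff: "f \<in> borel_measurable borel \<Longrightarrow> (LINT x|lborel. f (x - y)) = (LINT x|lborel. f x)"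
  using integrable_translate[of f "-y"] integral_translate[of f "-y"] by simp_all

lemma
  fixes f :: "'a::euclidean_space \<Rightarrow> real"
  shows integrable_reflect: "integrable lborel f \<Longrightarrow> integrable lborel (\<lambda>x. f (y - x))"
    and integral_reflect: "f \<in> borel_measurable borel \<Longrightarrow> (LINT x|lborel. f (y - x)) = (LINT x|lborel. f x)"
proof -
  have *: "distr lborel lborel (\<lambda>x. y - x) = lborel"
    using lborel_affine[of "-1" y] by (auto simp: density_1 cong: distr_cong)
  show "integrable lborel f \<Longrightarrow> integrable lborel (\<lambda>x. f (y - x))"
    using integrable_distr[of "\<lambda>x. y - x" lborel lborel f] * by simp
  show "(LINT x|lborel. f (y - x)) = (LINT x|lborel. f x)" if "f \<in> borel_measurable borel"
    using integral_distr[of "\<lambda>x. y - x" lborel lborel f] * that by simp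
qed

text \<open>Continuity at 0 of the orbit map of translations into L^1. The punctured filter loses
  nothing, as the integral vanishes at \<open>y = 0\<close>.\<close>

definition translation_continuous :: "('a::euclidean_space \<Rightarrow> real) \<Rightarrow> bool" where
  "translation_continuous f \<longleftrightarrow> ((\<lambda>y. LINT x|lborel. \<bar>f (x - y) - f x\<bar>) \<longlongrightarrow> 0) (at 0)"

text \<open>Translation is an isometry of L^1, so replacing \<open>f\<close> by \<open>g\<close>
  costs the L^1 distance twice, uniformly in \<open>y\<close>; the rest is an argument with
  \<open>e / 3\<close>.\<close>

lemma translation_continuous_approx:
  assumes f: "integrable lborel f"
    and "\<And>e. e > 0 \<Longrightarrow> \<exists>g. integrable lborel g \<and> translation_continuous g \<and> (LINT x|lborel. \<bar>f x - g x\<bar>) < e"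
  shows "translation_continuous f"
  unfolding translation_continuous_def
proof (rule tendstoI)
  fix e :: real assume "e > 0"
  then obtain g where g: "integrable lborel g" "translation_continuous g"
    and fg: "(LINT x|lborel. \<bar>f x - g x\<bar>) < e / 3"
    using assms(2)[of "e / 3"] by auto
  have [measurable]: "f \<in> borel_measurable borel" "g \<in> borel_measurable borel" using f g by auto
  have "\<forall>\<^sub>F y in at 0. dist (LINT x|lborel. \<bar>g (x - y) - g x\<bar>) 0 < e / 3"
    using g(2) \<open>e > 0\<close> unfolding translation_continuous_def by (intro tendstoD) auto
  then show "\<forall>\<^sub>F y in at 0. dist (LINT x|lborel. \<bar>f (x - y) - f x\<bar>) 0 < e"
  proof eventually_elim
    case (elim y)
    note [simp] = f g(1) integrable_translate_diff
    have "(LINT x|lborel. \<bar>f (x - y) - f x\<bar>) \<le>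
      (LINT x|lborel. \<bar>f (x - y) - g (x - y)\<bar> + \<bar>g (x - y) - g x\<bar> + \<bar>f x - g x\<bar>)"
      by (intro integral_mono) auto
    also have "\<dots> = (LINT x|lborel. \<bar>f (x - y) - g (x - y)\<bar>) + (LINT x|lborel. \<bar>g (x - y) - g x\<bar>) + (LINT x|lborel. \<bar>f x - g x\<bar>)"
      by (subst Bochner_Integration.integral_add; simp)+
    also have "(LINT x|lborel. \<bar>f (x - y) - g (x - y)\<bar>) = (LINT x|lborel. \<bar>f x - g x\<bar>)"
      using integral_translate_diff[of "\<lambda>x. \<bar>f x - g x\<bar>" y] by simp
    finally show ?case using elim fg by simp
  qed
qed

text \<open>For open \<open>U\<close> the positive part of \<open>1\<^sub>U x - 1\<^sub>U (x - y)\<close> tends to 0 pointwise as \<open>y\<close> tends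
  to 0, and the integral of the modulus is twice that of the positive part.\<close>

lemma translation_continuous_indicator_open:
  fixes U :: "'a::euclidean_space set"
  assumes U: "open U" "emeasure lborel U < \<infinity>"
  shows "translation_continuous (indicat_real U)"
proof -
  have [measurable]: "U \<in> sets borel" using U by auto
  let ?f = "indicat_real U"
  have int: "integrable lborel ?f" using U by simp
  note [simp] = int integrable_translate_diff[OF int]
  have eq: "(LINT x|lborel. \<bar>?f (x - y) - ?f x\<bar>) = 2 * (LINT x|lborel. max 0 (?f x - ?f (x - y)))" for y
  proof -
    \<comment> \<open>For reals, \<open>\<bar>b - a\<bar> = 2 * max 0 (a - b) + b - a\<close>; the
      last two terms have equal integrals by translation invariance.\<close>
    have "(LINT x|lborel. \<bar>?f (x - y) - ?f x\<bar>) = (LINT x|lborel. 2 * max 0 (?f x - ?f (x - y)) + ?f (x - y) - ?f x)"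
      by (intro Bochner_Integration.integral_cong) (auto simp: indicator_def)
    also have "\<dots> = 2 * (LINT x|lborel. max 0 (?f x - ?f (x - y))) + (LINT x|lborel. ?f (x - y)) - (LINT x|lborel. ?f x)"
      by simp
    also have "(LINT x|lborel. ?f (x - y)) = (LINT x|lborel. ?f x)"
      by (rule integral_translate_diff) simp
    finally show ?thesis by simp
  qed
  have "((\<lambda>y. LINT x|lborel. max 0 (?f x - ?f (x - y))) \<longlongrightarrow> 0) (at 0)"
    unfolding tendsto_at_iff_sequentially comp_def
  proof (intro allI impI)
    fix X :: "nat \<Rightarrow> 'a" assume X: "X \<longlonglongrightarrow> 0"
    have "(\<lambda>i. LINT x|lborel. max 0 (?f x - ?f (x - X i))) \<longlonglongrightarrow> (LINT x|(lborel :: 'a measure). 0)"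
    proof (rule integral_dominated_convergence)
      show "AE x in lborel. (\<lambda>i. max 0 (?f x - ?f (x - X i))) \<longlonglongrightarrow> 0"
      proof (rule AE_I2)
        fix x :: 'a
        show "(\<lambda>i. max 0 (?f x - ?f (x - X i))) \<longlonglongrightarrow> 0"
        proof (cases "x \<in> U")
          case True
          have "(\<lambda>i. x - X i) \<longlonglongrightarrow> x" using tendsto_diff[OF tendsto_const X, of x] by simp
          then have "\<forall>\<^sub>F i in sequentially. x - X i \<in> U" using topological_tendstoD U(1) True by metis
          then have "\<forall>\<^sub>F i in sequentially. max 0 (?f x - ?f (x - X i)) = 0"
            by eventually_elim (auto simp: True)
          then show ?thesis by (simp add: tendsto_eventually)
        qed (auto simp: indicator_def)
      qed
      \<comment> \<open>This majorant does not depend on the translation. The modulus is not bounded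
        by it, hence the passage to the positive part.\<close>
      show "AE x in lborel. norm (max 0 (?f x - ?f (x - X i))) \<le> ?f x" for i
        by (rule AE_I2) (auto simp: indicator_def)
    qed auto
    then show "(\<lambda>i. LINT x|lborel. max 0 (?f x - ?f (x - X i))) \<longlonglongrightarrow> 0" by simp
  qed
  from tendsto_mult_right_zero[OF this, of 2] show ?thesis
    unfolding translation_continuous_def eq by simp
qed

text \<open>Integrable functions arise from indicators of sets of finite measure by sums and
  dominated limits. Outer regularity approximates the indicators by those of open sets, sums use the
  triangle inequality, and dominated limits are L^1 limits.\<close>

lemma integrable_imp_translation_continuous:
  fixes f :: "'a::euclidean_space \<Rightarrow> real"
  assumes "integrable lborel f"
  shows "translation_continuous f"
  using assms
proof (induction rule: integrable_induct)
  case (base A c)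
  then have A[measurable]: "A \<in> sets borel" by simp
  note intA = integrable_real_indicator[OF base]
  have ind: "translation_continuous (indicat_real A)"
  proof (rule translation_continuous_approx)
    show "integrable lborel (indicat_real A)" by (fact intA)
    fix e :: real assume "e > 0"
    then obtain U where U: "open U" "A \<subseteq> U" "emeasure lborel (U - A) < e"
      using outer_regular_lborel[OF A] by blast
    have [measurable]: "U \<in> sets borel" using U by auto
    have finD: "emeasure lborel (U - A) < \<infinity>" using U(3) by (auto simp: less_top intro: less_trans)
    have "emeasure lborel U = emeasure lborel A + emeasure lborel (U - A)"
      using U by (subst plus_emeasure) (auto intro!: arg_cong[of _ _ "emeasure lborel"])
    then have finU: "emeasure lborel U < \<infinity>" using base finD by simp
    have "(LINT x|lborel. \<bar>indicat_real A x - indicator U x\<bar>) = (LINT x|lborel. indicator (U - A) x)"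
      using U by (intro Bochner_Integration.integral_cong) (auto simp: indicator_def)
    also have "\<dots> = measure lborel (U - A)" by simp
    also have "\<dots> < e"
      using U(3) \<open>e > 0\<close> finD by (simp add: emeasure_eq_ennreal_measure less_top ennreal_less_iff)
    finally show "\<exists>g. integrable lborel g \<and> translation_continuous g \<and> (LINT x|lborel. \<bar>indicat_real A x - g x\<bar>) < e"
      using translation_continuous_indicator_open[OF U(1) finU] finU
      by (intro exI[of _ "indicat_real U"]) auto
  qed
  have "((\<lambda>y. \<bar>c\<bar> * (LINT x|lborel. \<bar>indicat_real A (x - y) - indicat_real A x\<bar>)) \<longlongrightarrow> 0) (at 0)"
    using tendsto_mult_right_zero[OF ind[unfolded translation_continuous_def]] .
  moreover have "\<bar>c\<bar> * (LINT x|lborel. \<bar>indicat_real A (x - y) - indicat_real A x\<bar>) =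
     (LINT x|lborel. \<bar>indicat_real A (x - y) *\<^sub>R c - indicat_real A x *\<^sub>R c\<bar>)" for y
    by (subst integral_mult_right_zero[symmetric])
       (auto intro!: Bochner_Integration.integral_cong simp: abs_mult[symmetric] algebra_simps)
  ultimately show ?case unfolding translation_continuous_def by simp
next
  case (add f g)
  have "((\<lambda>y. (LINT x|lborel. \<bar>f (x - y) - f x\<bar>) + (LINT x|lborel. \<bar>g (x - y) - g x\<bar>)) \<longlongrightarrow> 0) (at 0)"
    using tendsto_add[OF add.IH[unfolded translation_continuous_def]] by simp
  moreover have "(LINT x|lborel. \<bar>f (x - y) + g (x - y) - (f x + g x)\<bar>) \<le>
      (LINT x|lborel. \<bar>f (x - y) - f x\<bar>) + (LINT x|lborel. \<bar>g (x - y) - g x\<bar>)" for y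
  proof -
    note [simp] = add.hyps(1,2) integrable_translate_diff
    have "(LINT x|lborel. \<bar>f (x - y) + g (x - y) - (f x + g x)\<bar>) \<le>
        (LINT x|lborel. \<bar>f (x - y) - f x\<bar> + \<bar>g (x - y) - g x\<bar>)"
      by (rule integral_mono) auto
    then show ?thesis by simp
  qed
  ultimately show ?case unfolding translation_continuous_def
    by (elim Lim_null_comparison[rotated]) auto
next
  case (lim f s)
  show ?case
  proof (rule translation_continuous_approx)
    fix e :: real assume "e > 0"
    have [measurable]: "f \<in> borel_measurable borel" "s i \<in> borel_measurable borel" for i
      using lim borel_measurable_integrable by force+
    have "(\<lambda>i. LINT x|lborel. \<bar>f x - s i x\<bar>) \<longlonglongrightarrow> (LINT x|(lborel :: 'a measure). 0)"
    proof (rule integral_dominated_convergence)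
      \<comment> \<open>The induction rule supplies
        \<open>\<bar>s i x\<bar> \<le> 2 * \<bar>f x\<bar>\<close>, which gives the factor 3 for the
        difference.\<close>
      show "integrable lborel (\<lambda>x. 3 * \<bar>f x\<bar>)" using lim by simp
      show "AE x in lborel. (\<lambda>i. \<bar>f x - s i x\<bar>) \<longlonglongrightarrow> 0"
        
      proof (rule AE_I2)
        fix x show "(\<lambda>i. \<bar>f x - s i x\<bar>) \<longlonglongrightarrow> 0"
          using tendsto_rabs[OF tendsto_diff[OF tendsto_const lim.hyps(2)[of x]], of "f x"] by simp
      qed
      show "AE x in lborel. norm \<bar>f x - s i x\<bar> \<le> 3 * \<bar>f x\<bar>" for i
      proof (rule AE_I2)
        fix x show "norm \<bar>f x - s i x\<bar> \<le> 3 * \<bar>f x\<bar>" using lim.hyps(3)[of x i] by simp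
      qed
    qed auto
    then have "\<forall>\<^sub>F i in sequentially. (LINT x|lborel. \<bar>f x - s i x\<bar>) < e"
      using \<open>e > 0\<close> by (intro order_tendstoD) auto
    then show "\<exists>g. integrable lborel g \<and> translation_continuous g \<and> (LINT x|lborel. \<bar>f x - g x\<bar>) < e"
      using lim.hyps(1) lim.IH by (auto dest!: eventually_happens)
  qed (use lim in auto)
qed

subsection \<open>Continuously differentiable functions with bounded support\<close>

text \<open>The regularity clause of \<open>test_fields\<close>, with the derivative as an argument
  so that explicit formulas can be carried along; uniqueness of derivatives leads back to
  \<open>frechet_derivative\<close>.\<close>

definition has_C1_deriv ::
    "('a::euclidean_space \<Rightarrow> 'b::real_normed_vector) \<Rightarrow> ('a \<Rightarrow> 'a \<Rightarrow> 'b) \<Rightarrow> bool" where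
  "has_C1_deriv f f' \<longleftrightarrow>
     (\<forall>x. (f has_derivative f' x) (at x)) \<and> (\<forall>v. continuous_on UNIV (\<lambda>x. f' x v))"

text \<open>In Euclidean space this is equivalent to compactness of the closed support, and it
  passes to smaller supports without any closure argument.\<close>

definition bounded_supp :: "('a::euclidean_space \<Rightarrow> 'b::real_normed_vector) \<Rightarrow> bool" where
  "bounded_supp f \<longleftrightarrow> bounded {x. f x \<noteq> 0}"

lemma has_C1_derivD:
  assumes "has_C1_deriv f f'"
  shows "(f has_derivative f' x) (at x)" "continuous_on UNIV (\<lambda>x. f' x v)"
    "linear (f' x)" "continuous_on UNIV f"
proof -
  show d: "(f has_derivative f' x) (at x)" for x using assms unfolding has_C1_deriv_def by simp
  show "continuous_on UNIV (\<lambda>x. f' x v)" using assms unfolding has_C1_deriv_def by simp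
  show "linear (f' x)" by (rule has_derivative_linear[OF d])
  show "continuous_on UNIV f" using has_derivative_continuous[OF d] by (simp add: continuous_at_imp_continuous_on)
qed

lemma bounded_suppE:
  assumes "bounded_supp f"
  obtains R where "R > 0" "\<And>x. norm x > R \<Longrightarrow> f x = 0"
  using assms unfolding bounded_supp_def bounded_pos by (metis (mono_tags, lifting) mem_Collect_eq not_less)

lemma bounded_suppI: "(\<And>x. norm x > R \<Longrightarrow> f x = 0) \<Longrightarrow> bounded_supp f"
  unfolding bounded_supp_def by (rule bounded_subset[of "cball 0 R"]) (simp, metis (mono_tags) mem_Collect_eq mem_cball_0 not_le subsetI)

lemma bounded_supp_mult:
  fixes f g :: "'a::euclidean_space \<Rightarrow> real"
  shows "bounded_supp g \<Longrightarrow> bounded_supp (\<lambda>x. f x * g x)"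
  unfolding bounded_supp_def by (erule bounded_subset) auto

lemma bounded_supp_scaleR:
  "bounded_supp g \<Longrightarrow> bounded_supp (\<lambda>x. f x *\<^sub>R g x)"
  unfolding bounded_supp_def by (erule bounded_subset) auto

lemma bounded_supp_add:
  assumes "bounded_supp f" "bounded_supp g"
  shows "bounded_supp (\<lambda>x. f x + g x)"
proof -
  have "bounded ({x. f x \<noteq> 0} \<union> {x. g x \<noteq> 0})" using assms by (simp add: bounded_supp_def)
  then show ?thesis unfolding bounded_supp_def by (rule bounded_subset) auto
qed

text \<open>On the open exterior of a ball \<open>f\<close> is constantly 0, so 0 is a derivative
  there and uniqueness applies.\<close>

lemma bounded_supp_deriv:
  assumes f: "has_C1_deriv f f'" and b: "bounded_supp f"
  shows "bounded_supp (\<lambda>x. f' x v)"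
proof -
  obtain R where R: "\<And>x. norm x > R \<Longrightarrow> f x = 0" using b bounded_suppE by blast
  have "open {x :: 'a. norm x > R}" by (intro open_Collect_less continuous_intros)
  then have "f' x v = 0" if "norm x > R" for x
  proof -
    have "(f has_derivative (\<lambda>_. 0)) (at x)"
      by (rule has_derivative_transform_within_open[of "\<lambda>_. 0" _ _ _ "{x. norm x > R}"])
         (use that R \<open>open _\<close> in auto)
    then show ?thesis using has_derivative_unique[OF has_C1_derivD(1)[OF f]] by metis
  qed
  then show ?thesis by (rule bounded_suppI)
qed

lemma continuous_bounded_supp_bound:
  fixes f :: "'a::euclidean_space \<Rightarrow> 'b::real_normed_vector"
  assumes "continuous_on UNIV f" "bounded_supp f"
  obtains M where "M > 0" "\<And>x. norm (f x) \<le> M"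
proof -
  obtain R where R: "R > 0" "\<And>x. norm x > R \<Longrightarrow> f x = 0" using assms bounded_suppE by blast
  have "compact (f ` cball 0 R)"
    using assms(1) by (intro compact_continuous_image continuous_on_subset[OF assms(1)]) auto
  then obtain M where M: "M > 0" "\<And>x. norm x \<le> R \<Longrightarrow> norm (f x) \<le> M"
    using compact_imp_bounded bounded_pos by (metis (no_types, lifting) dist_0_norm image_eqI mem_cball)
  show ?thesis
  proof (rule that[OF M(1)])
    show "norm (f x) \<le> M" for x using M R(2)[of x] by (cases "norm x \<le> R") auto
  qed
qed

lemma continuous_bounded_supp_integrable:
  fixes f :: "'a::euclidean_space \<Rightarrow> real"
  assumes "continuous_on UNIV f" "bounded_supp f"
  shows "integrable lborel f"
proof -
  obtain R where R: "R > 0" "\<And>x. norm x > R \<Longrightarrow> f x = 0" using assms bounded_suppE by blast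
  have "integrable lborel (\<lambda>x. indicator (cball 0 R) x *\<^sub>R f x)"
    by (rule borel_integrable_compact) (auto intro: continuous_on_subset[OF assms(1)])
  also have "(\<lambda>x. indicator (cball 0 R) x *\<^sub>R f x) = f"
    using R(2) by (auto simp: indicator_def fun_eq_iff not_le)
  finally show ?thesis .
qed

text \<open>The factor \<open>g\<close> is bounded, so it costs a constant. The disjunction on
  \<open>M\<close> serves both \<open>lborel\<close>, where the analysis takes place, and
  \<open>lebesgue\<close>, where \<open>TV\<close> is defined.\<close>

lemma integrable_mult_continuous_bounded_supp:
  fixes f g :: "'a::euclidean_space \<Rightarrow> real"
  assumes "integrable M f" "sets M = sets borel \<or> M = lebesgue" "continuous_on UNIV g" "bounded_supp g"
  shows "integrable M (\<lambda>x. f x * g x)"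
proof -
  obtain B where B: "B > 0" "\<And>x. norm (g x) \<le> B" using continuous_bounded_supp_bound[OF assms(3,4)] by blast
  have [measurable]: "g \<in> borel_measurable borel" using assms(3) by (rule borel_measurable_continuous_onI)
  have [measurable]: "f \<in> borel_measurable M" using assms(1) by auto
  have [measurable]: "g \<in> borel_measurable M"
    using assms(2)
  proof
    assume "sets M = sets borel" then show ?thesis using measurable_cong_sets[of M borel] by auto
  qed (simp add: measurable_completion)
  show ?thesis
  proof (rule Bochner_Integration.integrable_bound)
    show "integrable M (\<lambda>x. B * f x)" using assms(1) by simp
    show "AE x in M. norm (f x * g x) \<le> norm (B * f x)"
    proof (rule AE_I2)
      fix x show "norm (f x * g x) \<le> norm (B * f x)"
        using mult_left_mono[OF B(2)[of x], of "\<bar>f x\<bar>"] B(1) by (simp add: abs_mult mult.commute)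
    qed
  qed measurable
qed

text \<open>Each derivative along a basis vector is continuous with bounded support, hence bounded;
  expanding \<open>v\<close> in the finite basis adds up these bounds.\<close>

lemma C1_deriv_bound:
  fixes f :: "'a::euclidean_space \<Rightarrow> 'b::real_normed_vector"
  assumes f: "has_C1_deriv f f'" and b: "bounded_supp f"
  obtains M where "M > 0" "\<And>x v. norm (f' x v) \<le> M * norm v"
proof -
  have "\<exists>M>0. \<forall>x. norm (f' x b) \<le> M" for b
    using continuous_bounded_supp_bound[OF has_C1_derivD(2)[OF f] bounded_supp_deriv[OF assms]] by metis
  then obtain m where m: "\<And>b. m b > 0" "\<And>b x. norm (f' x b) \<le> m b" by metis
  show ?thesis
  proof (rule that[of "(\<Sum>b\<in>Basis. m b)"])
    show "(\<Sum>b\<in>Basis. m b) > 0" using m by (intro sum_pos) auto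
    fix x v :: 'a
    interpret linear "f' x" by (rule has_C1_derivD[OF f])
    have "norm (f' x v) = norm (\<Sum>b\<in>Basis. (v \<bullet> b) *\<^sub>R f' x b)"
      using sum scale by (metis (no_types, lifting) euclidean_representation sum.cong)
    also have "\<dots> \<le> (\<Sum>b\<in>Basis. norm v * m b)"
      by (rule sum_norm_le) (auto intro!: mult_mono m simp: Basis_le_norm)
    also have "\<dots> = (\<Sum>b\<in>Basis. m b) * norm v" by (simp add: sum_distrib_left mult.commute)
    finally show "norm (f' x v) \<le> (\<Sum>b\<in>Basis. m b) * norm v" .
  qed
qed

lemma lipschitz_of_deriv_bound:
  assumes f: "has_C1_deriv f f'" and M: "\<And>x v. norm (f' x v) \<le> M * norm v"
  shows "norm (f x - f y) \<le> M * norm (x - y)"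
proof (rule differentiable_bound[of UNIV f f'])
  show "onorm (f' x) \<le> M" for x by (rule onorm_le) (rule M)
qed (use has_C1_derivD(1)[OF f] in auto)

section \<open>Derivatives of functions with bounded support integrate to zero\<close>

lemma difference_quotient_sequence:
  fixes f :: "'a::euclidean_space \<Rightarrow> real"
  assumes "(f has_derivative f') (at x)"
  shows "(\<lambda>n. real (Suc n) * (f (x + (1 / real (Suc n)) *\<^sub>R v) - f x)) \<longlonglongrightarrow> f' v"
proof -
  interpret bounded_linear f' by (rule has_derivative_bounded_linear[OF assms])
  have "((\<lambda>t. f (x + t *\<^sub>R v)) has_derivative (\<lambda>t. f' (t *\<^sub>R v))) (at 0)"
    by (rule has_derivative_compose[of "\<lambda>t. x + t *\<^sub>R v" "\<lambda>t. t *\<^sub>R v" _ _ f f'])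
       (use assms in \<open>auto intro!: derivative_eq_intros\<close>)
  then have "((\<lambda>t. f (x + t *\<^sub>R v)) has_field_derivative f' v) (at 0)"
    by (simp add: has_field_derivative_def scaleR mult.commute[of _ "f' v"] mult_commute_abs)
  then have "((\<lambda>t. (f (x + t *\<^sub>R v) - f x) / t) \<longlongrightarrow> f' v) (at 0)"
    by (simp add: DERIV_def)
  moreover have "filterlim (\<lambda>n. 1 / real (Suc n)) (at 0) sequentially"
    using LIMSEQ_Suc[OF lim_1_over_n[where 'a=real]] by (intro filterlim_atI) auto
  ultimately show ?thesis by (auto dest: filterlim_compose simp: mult.commute)
qed

text \<open>By translation invariance every difference quotient of \<open>f\<close> has integral 0,
  and the quotients converge to the directional derivative under an integrable majorant given by the
  Lipschitz bound.\<close>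

lemma integral_C1_deriv_eq_0:
  fixes f :: "'a::euclidean_space \<Rightarrow> real"
  assumes f: "has_C1_deriv f f'" and b: "bounded_supp f"
  shows "(LINT x|lborel. f' x v) = 0"
proof -
  have cf: "continuous_on UNIV f" by (rule has_C1_derivD[OF f])
  then have [measurable]: "f \<in> borel_measurable borel" by (rule borel_measurable_continuous_onI)
  have [measurable]: "(\<lambda>x. f' x v) \<in> borel_measurable borel"
    by (rule borel_measurable_continuous_onI) (rule has_C1_derivD[OF f])
  note intf = continuous_bounded_supp_integrable[OF cf b]
  obtain M where M: "M > 0" "\<And>x v. norm (f' x v) \<le> M * norm v" using C1_deriv_bound[OF assms] by blast
  obtain R where R: "R > 0" "\<And>x. norm x > R \<Longrightarrow> f x = 0" using b bounded_suppE by blast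
  define q where "q n x = real (Suc n) * (f (x + (1 / real (Suc n)) *\<^sub>R v) - f x)" for n x
  \<comment> \<open>The step sizes \<open>1 / Suc n\<close> are at most 1, so for \<open>x\<close>
    outside this ball both points of the quotient lie beyond radius \<open>R\<close>, where
    \<open>f\<close> vanishes.\<close>
  let ?B = "cball (0::'a) (R + norm v)"
  have "(\<lambda>n. LINT x|lborel. q n x) \<longlonglongrightarrow> (LINT x|lborel. f' x v)"
  proof (rule integral_dominated_convergence)
    show "integrable lborel (\<lambda>x. M * norm v * indicator ?B x)"
      by (intro integrable_mult_right integrable_real_indicator emeasure_lborel_cball_finite) simp
    show "AE x in lborel. (\<lambda>n. q n x) \<longlonglongrightarrow> f' x v"
      unfolding q_def by (intro AE_I2 difference_quotient_sequence has_C1_derivD[OF f])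
    show "AE x in lborel. norm (q n x) \<le> M * norm v * indicator ?B x" for n
    proof (rule AE_I2)
      fix x
      let ?y = "x + (1 / real (Suc n)) *\<^sub>R v"
      have nv: "norm ((1 / real (Suc n)) *\<^sub>R v) \<le> norm v"
        using mult_left_mono[of 1 "1 + real n" "norm v"] by (simp add: divide_simps)
      show "norm (q n x) \<le> M * norm v * indicator ?B x"
      proof (cases "x \<in> ?B")
        case True
        have "norm (q n x) = real (Suc n) * norm (f ?y - f x)" by (simp add: q_def abs_mult)
        also have "\<dots> \<le> real (Suc n) * (M * norm (?y - x))"
          using lipschitz_of_deriv_bound[OF f M(2), of ?y x] by (intro mult_left_mono) auto
        also have "\<dots> = M * norm v" by simp
        finally show ?thesis using True by simp
      next
        case False
        then have x: "norm x > R + norm v" by simp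
        moreover have "norm x \<le> norm ?y + norm v"
          using nv norm_triangle_ineq4[of ?y "(1 / real (Suc n)) *\<^sub>R v"] by simp
        ultimately have "norm ?y > R" by linarith
        moreover have "norm x > R" using x norm_ge_zero[of v] by linarith
        ultimately have "f ?y = 0" "f x = 0" by (auto simp only: R(2))
        then show ?thesis using False by (simp add: q_def)
      qed
    qed
  qed (auto simp: q_def)
  moreover have "(LINT x|lborel. q n x) = 0" for n
    unfolding q_def using intf integrable_translate[OF intf] by (simp add: integral_translate)
  ultimately show ?thesis by (simp add: LIMSEQ_const_iff)
qed

subsection \<open>Mollification\<close>

lemma bounded_supp_reflect:
  assumes "bounded_supp f"
  shows "bounded_supp (\<lambda>y. f (x - y))"
proof -
  obtain R where R: "\<And>x. norm x > R \<Longrightarrow> f x = 0" using assms bounded_suppE by blast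
  have "f (x - y) = 0" if "norm y > R + norm x" for y
    using norm_triangle_ineq2[of y x] that by (intro R) (simp add: norm_minus_commute)
  then show ?thesis by (rule bounded_suppI)
qed

text \<open>Squaring removes the kink of the positive part: at 0 the difference quotient is bounded
  by \<open>\<bar>h\<bar>\<close>. This makes a truncated polynomial usable as a kernel of class
  C^1.\<close>

lemma DERIV_max_0_power2: "((\<lambda>t. (max 0 t)\<^sup>2) has_real_derivative 2 * max 0 t) (at t)"
proof -
  consider "t < 0" | "t = 0" | "t > 0" by linarith
  then show ?thesis
  proof cases
    case 1
    have "((\<lambda>t. 0) has_real_derivative 0) (at t)" by simp
    then have "((\<lambda>t. (max 0 t)\<^sup>2) has_real_derivative 0) (at t)"
      by (rule has_field_derivative_transform_within_open[of _ _ _ "{..<0}"]) (use 1 in auto)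
    then show ?thesis using 1 by simp
  next
    case 2
    have "((\<lambda>h. (max 0 h)\<^sup>2 / h) \<longlongrightarrow> 0) (at (0::real))"
    proof (rule Lim_null_comparison)
      show "\<forall>\<^sub>F h in at 0. norm ((max 0 h)\<^sup>2 / h) \<le> \<bar>h\<bar>"
        by (auto intro!: always_eventually simp: max_def power2_eq_square)
      show "((\<lambda>h::real. \<bar>h\<bar>) \<longlongrightarrow> 0) (at 0)" by (intro tendsto_eq_intros) auto
    qed
    then show ?thesis using 2 by (simp add: DERIV_def)
  next
    case 3
    have "((\<lambda>t. t\<^sup>2) has_real_derivative 2 * t) (at t)" by (auto intro!: derivative_eq_intros)
    then have "((\<lambda>t. (max 0 t)\<^sup>2) has_real_derivative 2 * t) (at t)"
      by (rule has_field_derivative_transform_within_open[of _ _ _ "{0<..}"]) (use 3 in auto)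
    then show ?thesis using 3 by simp
  qed
qed

text \<open>The square of the positive part of \<open>r\<^sup>2 - x \<bullet> x\<close>, divided by
  its integral.\<close>

lemma mollifier_exists:
  fixes r :: real
  assumes "r > 0"
  obtains K :: "'a::euclidean_space \<Rightarrow> real" and K' where "has_C1_deriv K K'" "bounded_supp K"
    "\<And>x. K x \<ge> 0" "\<And>x. norm x \<ge> r \<Longrightarrow> K x = 0" "(LINT x|lborel. K x) = 1"
proof -
  define K0 :: "'a \<Rightarrow> real" where "K0 x = (max 0 (r\<^sup>2 - x \<bullet> x))\<^sup>2" for x
  define K0' :: "'a \<Rightarrow> 'a \<Rightarrow> real" where "K0' x v = 2 * max 0 (r\<^sup>2 - x \<bullet> x) * - (2 * (x \<bullet> v))" for x v
  have d: "(K0 has_derivative K0' x) (at x)" for x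
  proof -
    have "((\<lambda>x. r\<^sup>2 - x \<bullet> x) has_derivative (\<lambda>v. - (2 * (x \<bullet> v)))) (at x)"
      by (auto intro!: derivative_eq_intros simp: inner_commute)
    from has_derivative_compose[OF this DERIV_max_0_power2[unfolded has_field_derivative_def]]
    show ?thesis unfolding K0_def K0'_def .
  qed
  have C: "continuous_on UNIV K0" unfolding K0_def by (intro continuous_intros)
  have C': "continuous_on UNIV (\<lambda>x. K0' x v)" for v
    unfolding K0'_def by (intro continuous_intros)
  have z: "K0 x = 0" if "norm x \<ge> r" for x
  proof -
    have "r\<^sup>2 \<le> x \<bullet> x" using that assms by (simp add: dot_square_norm power_mono)
    then show ?thesis by (simp add: K0_def)
  qed
  have b: "bounded_supp K0" by (rule bounded_suppI[of r]) (use z in auto)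
  note int = continuous_bounded_supp_integrable[OF C b]
  define I where "I = (LINT x|lborel. K0 x)"
  have "I > 0"
  proof -
    \<comment> \<open>A lower bound for \<open>K0\<close> on the ball of radius
      \<open>r / 2\<close>, where \<open>x \<bullet> x \<le> r\<^sup>2 / 4\<close>; that ball has
      positive measure.\<close>
    let ?c = "(3 / 4 * r\<^sup>2)\<^sup>2"
    have "0 < ?c * measure lborel (ball (0::'a) (r / 2))"
      using assms by (intro mult_pos_pos content_ball_pos) auto
    also have "\<dots> = (LINT x|lborel. ?c * indicat_real (ball (0::'a) (r / 2)) x)" by simp
    also have "\<dots> \<le> I" unfolding I_def
    proof (rule integral_mono)
      show "integrable lborel (\<lambda>x. ?c * indicat_real (ball (0::'a) (r / 2)) x)"
        by (intro integrable_mult_right integrable_real_indicator emeasure_lborel_ball_finite) simp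
      show "integrable lborel K0" by (rule int)
      fix x :: 'a
      show "?c * indicat_real (ball 0 (r / 2)) x \<le> K0 x"
      proof (cases "x \<in> ball 0 (r / 2)")
        case True
        then have "(norm x)\<^sup>2 \<le> (r / 2)\<^sup>2" by (intro power_mono) auto
        then have "3 / 4 * r\<^sup>2 \<le> r\<^sup>2 - x \<bullet> x" by (simp add: dot_square_norm power_divide)
        then have "?c \<le> (max 0 (r\<^sup>2 - x \<bullet> x))\<^sup>2" by (intro power_mono max.coboundedI2) auto
        then show ?thesis using True by (simp add: K0_def)
      qed (simp add: K0_def)
    qed
    finally show ?thesis .
  qed
  show ?thesis
  proof (rule that)
    show "has_C1_deriv (\<lambda>x. K0 x / I) (\<lambda>x v. K0' x v / I)"
      unfolding has_C1_deriv_def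
    proof (intro allI conjI)
      show "((\<lambda>x. K0 x / I) has_derivative (\<lambda>v. K0' x v / I)) (at x)" for x
        using has_derivative_mult_right[OF d[of x], of "1 / I"] by simp
      show "continuous_on UNIV (\<lambda>x. K0' x v / I)" for v
        using C'[of v] \<open>I > 0\<close> by (intro continuous_intros) auto
    qed
    show "bounded_supp (\<lambda>x. K0 x / I)" using bounded_supp_mult[OF b, of "\<lambda>_. 1 / I"] by simp
    show "K0 x / I \<ge> 0" for x using \<open>I > 0\<close> by (simp add: K0_def)
    show "K0 x / I = 0" if "norm x \<ge> r" for x using z[OF that] by simp
    show "(LINT x|lborel. K0 x / I) = 1" using \<open>I > 0\<close> by (simp add: I_def)
  qed
qed

section \<open>Convolution of an integrable function with a kernel of class C^1\<close>

lemma convolution_integrable: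
  fixes p w :: "'a::euclidean_space \<Rightarrow> real"
  assumes "integrable lborel w" "continuous_on UNIV p" "bounded_supp p"
  shows "integrable lborel (\<lambda>y. w y * p (x - y))"
  by (rule integrable_mult_continuous_bounded_supp[OF assms(1) _ _ bounded_supp_reflect[OF assms(3)]])
     (auto intro!: continuous_intros continuous_on_compose2[OF assms(2)])

text \<open>The derivative falls on the kernel. Both differentiability and continuity of the
  derivative follow by dominated convergence, with a multiple of \<open>\<bar>w\<bar>\<close> as
  majorant.\<close>

lemma convolution_has_C1_deriv:
  fixes K w :: "'a::euclidean_space \<Rightarrow> real"
  assumes K: "has_C1_deriv K K'" "bounded_supp K" and w: "integrable lborel w"
  shows "has_C1_deriv (\<lambda>x. LINT y|lborel. w y * K (x - y)) (\<lambda>x v. LINT y|lborel. w y * K' (x - y) v)"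
proof -
  obtain M where M: "M > 0" "\<And>x v. norm (K' x v) \<le> M * norm v" using C1_deriv_bound[OF K] by blast
  have [measurable]: "w \<in> borel_measurable borel" using w by auto
  have [measurable]: "K \<in> borel_measurable borel"
    by (rule borel_measurable_continuous_onI) (rule has_C1_derivD[OF K(1)])
  have [measurable]: "(\<lambda>x. K' x v) \<in> borel_measurable borel" for v
    by (rule borel_measurable_continuous_onI) (rule has_C1_derivD[OF K(1)])
  have int: "integrable lborel (\<lambda>y. w y * K (x - y))" for x
    by (rule convolution_integrable[OF w has_C1_derivD(4)[OF K(1)] K(2)])
  have int': "integrable lborel (\<lambda>y. w y * K' (x - y) v)" for x v
    by (rule convolution_integrable[OF w has_C1_derivD(2)[OF K(1)] bounded_supp_deriv[OF K]])
  note lin = has_C1_derivD(3)[OF K(1)]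
  define g where "g x = (LINT y|lborel. w y * K (x - y))" for x
  define g' where "g' x v = (LINT y|lborel. w y * K' (x - y) v)" for x v
  have bl: "bounded_linear (g' x)" for x
  proof (rule bounded_linear_intro)
    show "g' x (u + v) = g' x u + g' x v" for u v
      unfolding g'_def by (simp add: linear_add[OF lin] distrib_left int')
    show "g' x (c *\<^sub>R v) = c *\<^sub>R g' x v" for c v
      unfolding g'_def by (simp add: linear_scale[OF lin] mult.left_commute[of _ c])
    show "norm (g' x v) \<le> norm v * (M * (LINT y|lborel. \<bar>w y\<bar>))" for v
    proof -
      have "norm (g' x v) \<le> (LINT y|lborel. norm (w y * K' (x - y) v))"
        unfolding g'_def by (rule integral_norm_bound)
      also have "\<dots> \<le> (LINT y|lborel. \<bar>w y\<bar> * (M * norm v))"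
        using w int' M(2) by (intro integral_mono integrable_norm) (auto simp: abs_mult intro!: mult_left_mono)
      finally show ?thesis by (simp add: ac_simps)
    qed
  qed
  have "((\<lambda>h. norm (g (x + h) - g x - g' x h) / norm h) \<longlongrightarrow> 0) (at 0)" for x
    unfolding tendsto_at_iff_sequentially comp_def
  proof (intro allI impI)
    fix X :: "nat \<Rightarrow> 'a" assume X0: "\<forall>i. X i \<in> UNIV - {0}" and X: "X \<longlonglongrightarrow> 0"
    \<comment> \<open>The normalized remainder of the linear expansion of \<open>K\<close> at
      \<open>x - y\<close>. It tends to 0 pointwise; the Lipschitz estimate and the derivative bound
      contribute \<open>M\<close> each to its bound.\<close>
    define q where "q n y = (K (x - y + X n) - K (x - y) - K' (x - y) (X n)) / norm (X n)" for n y
    have qM: "norm (q n y) \<le> 2 * M" for n y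
    proof -
      have "norm (K (x - y + X n) - K (x - y) - K' (x - y) (X n)) \<le> M * norm (X n) + M * norm (X n)"
        using norm_triangle_ineq4 lipschitz_of_deriv_bound[OF K(1) M(2), of "x - y + X n" "x - y"] M(2)[of "x - y" "X n"]
        by (smt (verit) add_diff_cancel_left')
      then show ?thesis using X0 by (simp add: q_def divide_simps)
    qed
    have "(\<lambda>n. LINT y|lborel. w y * q n y) \<longlonglongrightarrow> (LINT y|(lborel::'a measure). 0)"
    proof (rule integral_dominated_convergence)
      show "integrable lborel (\<lambda>y. 2 * M * \<bar>w y\<bar>)" using w by simp
      show "AE y in lborel. norm (w y * q n y) \<le> 2 * M * \<bar>w y\<bar>" for n
      proof (rule AE_I2)
        fix y show "norm (w y * q n y) \<le> 2 * M * \<bar>w y\<bar>"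
          using mult_left_mono[OF qM[of n y], of "\<bar>w y\<bar>"] by (simp add: abs_mult mult.commute)
      qed
      show "AE y in lborel. (\<lambda>n. w y * q n y) \<longlonglongrightarrow> 0"
      proof (rule AE_I2)
        fix y
        have "((\<lambda>h. norm (K (x - y + h) - K (x - y) - K' (x - y) h) / norm h) \<longlongrightarrow> 0) (at 0)"
          using has_C1_derivD(1)[OF K(1), of "x - y"] by (simp add: has_derivative_at)
        then have "(\<lambda>n. norm (q n y)) \<longlonglongrightarrow> 0"
          using X0 X unfolding tendsto_at_iff_sequentially comp_def q_def by simp
        then show "(\<lambda>n. w y * q n y) \<longlonglongrightarrow> 0"
          by (intro tendsto_mult_right_zero) (rule tendsto_norm_zero_cancel)
      qed
    qed (auto simp: q_def)
    moreover have "norm (LINT y|lborel. w y * q n y) = norm (g (x + X n) - g x - g' x (X n)) / norm (X n)" for n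
    proof -
      have "(LINT y|lborel. w y * q n y) =
        (LINT y|lborel. (w y * K (x + X n - y) - w y * K (x - y) - w y * K' (x - y) (X n)) / norm (X n))"
        by (intro Bochner_Integration.integral_cong) (auto simp: q_def algebra_simps diff_divide_distrib add_divide_distrib)
      also have "\<dots> = (g (x + X n) - g x - g' x (X n)) / norm (X n)"
        unfolding g_def g'_def by (simp add: int int')
      finally show ?thesis by simp
    qed
    ultimately show "(\<lambda>n. norm (g (x + X n) - g x - g' x (X n)) / norm (X n)) \<longlonglongrightarrow> 0"
      using tendsto_norm_zero by fastforce
  qed
  then have "(g has_derivative g' x) (at x)" for x
    using bl by (simp add: has_derivative_at)
  moreover have "continuous_on UNIV (\<lambda>x. g' x v)" for v
  proof (intro continuous_at_imp_continuous_on ballI)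
    fix x
    show "isCont (\<lambda>x. g' x v) x"
      unfolding continuous_at_sequentially comp_def
    proof (intro allI impI)
      fix X :: "nat \<Rightarrow> 'a" assume X: "X \<longlonglongrightarrow> x"
      show "(\<lambda>n. g' (X n) v) \<longlonglongrightarrow> g' x v"
        unfolding g'_def
      proof (rule integral_dominated_convergence)
        show "integrable lborel (\<lambda>y. M * norm v * \<bar>w y\<bar>)" using w by simp
        show "AE y in lborel. norm (w y * K' (X n - y) v) \<le> M * norm v * \<bar>w y\<bar>" for n
        proof (rule AE_I2)
          fix y show "norm (w y * K' (X n - y) v) \<le> M * norm v * \<bar>w y\<bar>"
            using mult_left_mono[OF M(2)[of "X n - y" v], of "\<bar>w y\<bar>"] by (simp add: abs_mult mult.commute)
        qed
        show "AE y in lborel. (\<lambda>n. w y * K' (X n - y) v) \<longlonglongrightarrow> w y * K' (x - y) v"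
        proof (rule AE_I2)
          fix y
          have "isCont (\<lambda>x. K' x v) (x - y)"
            using has_C1_derivD(2)[OF K(1)] by (simp add: continuous_on_eq_continuous_at)
          then show "(\<lambda>n. w y * K' (X n - y) v) \<longlonglongrightarrow> w y * K' (x - y) v"
            by (intro tendsto_mult tendsto_const isCont_tendsto_compose[of _ "\<lambda>x. K' x v"] tendsto_diff X)
        qed
      qed auto
    qed
  qed
  ultimately show ?thesis unfolding has_C1_deriv_def g_def g'_def by blast
qed

text \<open>\<open>g\<close> is an average of translates of \<open>w\<close> over small vectors.
  Hence it is close to \<open>w\<close> in L^1, and its integral against \<open>p\<close> is an
  average of integrals of \<open>w\<close> against translates of \<open>p\<close>. The last clause
  states the latter as transport of an upper bound, ready for divergences of test fields.\<close>

lemma mollification: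
  fixes w :: "'a::euclidean_space \<Rightarrow> real"
  assumes w: "integrable lborel w" and "e > 0"
  obtains g g' where "has_C1_deriv g g'" "integrable lborel g" "(LINT x|lborel. \<bar>g x - w x\<bar>) < e"
    "\<And>p T. \<lbrakk>continuous_on UNIV p; bounded_supp p; \<And>y. (LINT x|lborel. w x * p (x + y)) \<le> T\<rbrakk> \<Longrightarrow>
       (LINT x|lborel. g x * p x) \<le> T"
proof -
  let ?\<omega> = "\<lambda>y. LINT x|lborel. \<bar>w (x - y) - w x\<bar>"
  have "\<forall>\<^sub>F y in at 0. dist (?\<omega> y) 0 < e / 2"
    using integrable_imp_translation_continuous[OF w] \<open>e > 0\<close>
    unfolding translation_continuous_def by (intro tendstoD) auto
  then obtain d where d: "d > 0" "\<And>y. y \<noteq> 0 \<Longrightarrow> norm y < d \<Longrightarrow> ?\<omega> y < e / 2"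
    unfolding eventually_at by (auto simp: dist_norm)
  have \<omega>: "?\<omega> y \<le> e / 2" if "norm y < d" for y
    using d(2)[of y] that \<open>e > 0\<close> by (cases "y = 0") auto
  obtain K K' where K: "has_C1_deriv K K'" "bounded_supp K"
    "\<And>x::'a. K x \<ge> (0::real)" "\<And>x. norm x \<ge> d \<Longrightarrow> K x = 0" "(LINT x|lborel. K x) = 1"
    by (rule mollifier_exists[OF d(1), where 'a = 'a]) blast
  have cK: "continuous_on UNIV K" by (rule has_C1_derivD[OF K(1)])
  have [measurable]: "K \<in> borel_measurable borel" by (rule borel_measurable_continuous_onI) (rule cK)
  have [measurable]: "w \<in> borel_measurable borel" using w by auto
  note Kint = continuous_bounded_supp_integrable[OF cK K(2)]
  define g where "g x = (LINT y|lborel. w y * K (x - y))" for x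
  \<comment> \<open>The form with \<open>K (x - y)\<close> lets derivatives fall on the kernel; the
    reflected form exhibits \<open>g\<close> as a weighted mean of translates of
    \<open>w\<close>.\<close>
  have g_eq: "g x = (LINT y|lborel. K y * w (x - y))" for x
    using integral_reflect[of "\<lambda>y. w y * K (x - y)" x] by (simp add: g_def mult.commute)
  have Kw_int: "integrable lborel (\<lambda>y. K y * w (x - y))" for x
    using integrable_reflect[OF convolution_integrable[OF w cK K(2), of x], of x] by (simp add: mult.commute)
  \<comment> \<open>Joint integrability justifies exchanging the integrals; it holds because the L^1
    norm of a translate of \<open>w\<close> does not depend on \<open>y\<close>.\<close>
  have F: "integrable (lborel \<Otimes>\<^sub>M lborel) (\<lambda>(y, x). K y * w (x - y))"
  proof (rule lborel_pair.Fubini_integrable)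
    have "(LINT x|lborel. norm (K y * w (x - y))) = K y * (LINT x|lborel. \<bar>w x\<bar>)" for y
      using integral_translate_diff[of "\<lambda>x. \<bar>w x\<bar>" y] by (simp add: abs_mult K(3))
    then show "integrable lborel (\<lambda>y. LINT x|lborel. norm (case (y, x) of (y, x) \<Rightarrow> K y * w (x - y)))"
      using Kint by simp
    show "AE y in lborel. integrable lborel (\<lambda>x. case (y, x) of (y, x) \<Rightarrow> K y * w (x - y))"
      using integrable_translate_diff[OF w] by simp
  qed measurable
  have G: "integrable (lborel \<Otimes>\<^sub>M lborel) (\<lambda>(y, x). K y * w x)"
    by (rule lborel_pair.Fubini_integrable) (use w Kint in \<open>auto simp: abs_mult\<close>)
  have FG: "integrable (lborel \<Otimes>\<^sub>M lborel) (\<lambda>(y, x). K y * \<bar>w (x - y) - w x\<bar>)"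
  proof -
    have "(\<lambda>(y, x). K y * \<bar>w (x - y) - w x\<bar>) = (\<lambda>z. \<bar>(case z of (y, x) \<Rightarrow> K y * w (x - y)) - (case z of (y, x) \<Rightarrow> K y * w x)\<bar>)"
      using K(3) by (auto simp: fun_eq_iff right_diff_distrib[symmetric] abs_mult)
    then show ?thesis by (simp only:) (intro integrable_abs Bochner_Integration.integrable_diff F G)
  qed
  show ?thesis
  proof (rule that)
    show "has_C1_deriv g (\<lambda>x v. LINT y|lborel. w y * K' (x - y) v)"
      unfolding g_def by (rule convolution_has_C1_deriv[OF K(1,2) w])
    show gint: "integrable lborel g"
      unfolding g_eq by (rule lborel_pair.integrable_snd) (rule F)
    have "(LINT x|lborel. \<bar>g x - w x\<bar>) \<le> (LINT x|lborel. (LINT y|lborel. K y * \<bar>w (x - y) - w x\<bar>))"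
    proof (rule integral_mono)
      show "integrable lborel (\<lambda>x. \<bar>g x - w x\<bar>)" using gint w by simp
      show "integrable lborel (\<lambda>x. LINT y|lborel. K y * \<bar>w (x - y) - w x\<bar>)"
        by (rule lborel_pair.integrable_snd) (rule FG)
      fix x
      have "g x - w x = (LINT y|lborel. K y * (w (x - y) - w x))"
        using Kw_int[of x] Kint K(5) by (simp add: g_eq right_diff_distrib)
      also have "\<bar>\<dots>\<bar> \<le> (LINT y|lborel. \<bar>K y * (w (x - y) - w x)\<bar>)"
        by (rule integral_abs_bound)
      finally show "\<bar>g x - w x\<bar> \<le> (LINT y|lborel. K y * \<bar>w (x - y) - w x\<bar>)"
        by (simp add: abs_mult K(3))
    qed
    also have "\<dots> = (LINT y|lborel. (LINT x|lborel. K y * \<bar>w (x - y) - w x\<bar>))"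
      by (rule lborel_pair.Fubini_integral) (rule FG)
    also have "\<dots> \<le> (LINT y|lborel. K y * (e / 2))"
    proof (rule integral_mono)
      show "integrable lborel (\<lambda>y. LINT x|lborel. K y * \<bar>w (x - y) - w x\<bar>)"
        by (rule lborel_pair.integrable_fst) (rule FG)
      show "integrable lborel (\<lambda>y. K y * (e / 2))" using Kint by simp
      \<comment> \<open>Either \<open>norm y < d\<close> and the modulus of continuity is at most
        \<open>e / 2\<close>, or \<open>K y = 0\<close>.\<close>
      show "(LINT x|lborel. K y * \<bar>w (x - y) - w x\<bar>) \<le> K y * (e / 2)" for y
        using mult_left_mono[OF \<omega> K(3), of y y] K(4)[of y] by (cases "norm y < d") auto
    qed
    also have "\<dots> < e" using K(5) \<open>e > 0\<close> by simp
    finally show "(LINT x|lborel. \<bar>g x - w x\<bar>) < e" .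
    fix p :: "'a \<Rightarrow> real" and T
    assume p: "continuous_on UNIV p" "bounded_supp p" and T: "\<And>y. (LINT x|lborel. w x * p (x + y)) \<le> T"
    obtain B where B: "B > 0" "\<And>x. norm (p x) \<le> B" using continuous_bounded_supp_bound[OF p] by blast
    have [measurable]: "p \<in> borel_measurable borel" using p(1) by (rule borel_measurable_continuous_onI)
    have H: "integrable (lborel \<Otimes>\<^sub>M lborel) (\<lambda>(y, x). K y * w (x - y) * p x)"
    proof (rule Bochner_Integration.integrable_bound)
      show "integrable (lborel \<Otimes>\<^sub>M lborel) (\<lambda>z. B * (case z of (y, x) \<Rightarrow> K y * w (x - y)))" using F by simp
      show "AE z in lborel \<Otimes>\<^sub>M lborel. norm (case z of (y, x) \<Rightarrow> K y * w (x - y) * p x)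
          \<le> norm (B * (case z of (y, x) \<Rightarrow> K y * w (x - y)))"
      proof (rule AE_I2, clarify)
        fix y x :: 'a
        show "norm (K y * w (x - y) * p x) \<le> norm (B * (K y * w (x - y)))"
          using mult_left_mono[OF B(2)[of x], of "\<bar>K y * w (x - y)\<bar>"] B(1) by (simp add: abs_mult mult.commute)
      qed
    qed measurable
    have "(LINT x|lborel. g x * p x) = (LINT x|lborel. (LINT y|lborel. K y * w (x - y) * p x))"
      by (simp add: g_eq)
    also have "\<dots> = (LINT y|lborel. (LINT x|lborel. K y * w (x - y) * p x))"
      by (rule lborel_pair.Fubini_integral) (rule H)
    also have "\<dots> \<le> (LINT y|lborel. K y * T)"
    proof (rule integral_mono)
      show "integrable lborel (\<lambda>y. LINT x|lborel. K y * w (x - y) * p x)"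
        by (rule lborel_pair.integrable_fst) (rule H)
      show "integrable lborel (\<lambda>y. K y * T)" using Kint by simp
      fix y
      have "(LINT x|lborel. K y * w (x - y) * p x) = K y * (LINT x|lborel. w (x - y) * p x)"
        by (simp add: mult.assoc)
      also have "(LINT x|lborel. w (x - y) * p x) = (LINT x|lborel. w x * p (x + y))"
        using integral_translate_diff[of "\<lambda>x. w x * p (x + y)" y] by simp
      finally show "(LINT x|lborel. K y * w (x - y) * p x) \<le> K y * T"
        using T[of y] K(3)[of y] by (simp add: mult_left_mono)
    qed
    also have "\<dots> = T" using K(5) by simp
    finally show "(LINT x|lborel. g x * p x) \<le> T" .
  qed
qed

subsection \<open>Divergence and test fields\<close>

lemma test_fieldsD:
  assumes "\<phi> \<in> test_fields"
  shows "has_C1_deriv \<phi> (\<lambda>x. frechet_derivative \<phi> (at x))" "bounded_supp \<phi>" "norm (\<phi> x) \<le> 1"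
  using assms unfolding test_fields_def has_C1_deriv_def bounded_supp_def compact_closure
  by (auto simp: frechet_derivative_works)

lemma has_C1_deriv_imp_frechet:
  assumes "has_C1_deriv f f'"
  shows "f' = (\<lambda>x. frechet_derivative f (at x))"
  using frechet_derivative_at[OF has_C1_derivD(1)[OF assms]] by (rule ext)

lemma C1_frechet: "has_C1_deriv f f' \<Longrightarrow> has_C1_deriv f (\<lambda>x. frechet_derivative f (at x))"
  using has_C1_deriv_imp_frechet[of f f'] by simp

lemma test_fieldsI:
  assumes "has_C1_deriv \<phi> \<phi>'" "bounded_supp \<phi>" "\<And>x. norm (\<phi> x) \<le> 1"
  shows "\<phi> \<in> test_fields"
proof -
  have "\<phi> differentiable at x" for x using has_C1_derivD(1)[OF assms(1)] by (rule differentiableI)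
  moreover have "continuous_on UNIV (\<lambda>x. frechet_derivative \<phi> (at x) v)" for v
    using has_C1_derivD(2)[OF assms(1), of v] by (subst (asm) has_C1_deriv_imp_frechet[OF assms(1)])
  ultimately show ?thesis
    using assms(2,3) by (simp add: test_fields_def bounded_supp_def compact_closure)
qed

lemma divergence_eq:
  "has_C1_deriv \<phi> \<phi>' \<Longrightarrow> divergence \<phi> x = (\<Sum>b\<in>Basis. \<phi>' x b \<bullet> b)"
  unfolding divergence_def by (subst has_C1_deriv_imp_frechet[of \<phi> \<phi>']) auto

lemma bounded_supp_sum:
  "(\<And>i. i \<in> I \<Longrightarrow> bounded_supp (f i)) \<Longrightarrow> bounded_supp (\<lambda>x. \<Sum>i\<in>I. f i x)"
proof (induction I rule: infinite_finite_induct)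
  case (insert i I)
  then show ?case using bounded_supp_add[of "f i" "\<lambda>x. \<Sum>i\<in>I. f i x"] by simp
qed (simp_all add: bounded_supp_def)

text \<open>The divergence is a finite sum of partial derivatives of the components of
  \<open>\<phi>\<close>, which are scalar functions of class C^1 with bounded support.\<close>

lemma
  assumes "has_C1_deriv \<phi> \<phi>'" "bounded_supp \<phi>"
  shows continuous_on_divergence: "continuous_on UNIV (divergence \<phi>)"
    and bounded_supp_divergence: "bounded_supp (divergence \<phi>)"
    and integral_divergence_eq_0: "(LINT x|lborel. divergence \<phi> x) = 0"
proof -
  have eq: "divergence \<phi> = (\<lambda>x. \<Sum>b\<in>Basis. \<phi>' x b \<bullet> b)"
    by (rule ext) (rule divergence_eq[OF assms(1)])
  have C1: "has_C1_deriv (\<lambda>x. \<phi> x \<bullet> b) (\<lambda>x v. \<phi>' x v \<bullet> b)" for b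
    using assms(1) unfolding has_C1_deriv_def
    by (auto intro!: has_derivative_inner_left continuous_intros)
  have b: "bounded_supp (\<lambda>x. \<phi> x \<bullet> b)" for b
    using assms(2) unfolding bounded_supp_def by (rule bounded_subset) auto
  have b': "bounded_supp (\<lambda>x. \<phi>' x v \<bullet> b)" for v b by (rule bounded_supp_deriv[OF C1 b])
  show "continuous_on UNIV (divergence \<phi>)"
    unfolding eq by (intro continuous_intros has_C1_derivD[OF assms(1)])
  show "bounded_supp (divergence \<phi>)"
    unfolding eq by (intro bounded_supp_sum b')
  show "(LINT x|lborel. divergence \<phi> x) = 0"
    unfolding eq using integral_C1_deriv_eq_0[OF C1 b]
      continuous_bounded_supp_integrable[OF has_C1_derivD(2)[OF C1] b']
    by (subst Bochner_Integration.integral_sum) auto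
qed

section \<open>Sums, translates and weighted fields\<close>

lemma has_C1_deriv_add:
  "has_C1_deriv f f' \<Longrightarrow> has_C1_deriv g g' \<Longrightarrow> has_C1_deriv (\<lambda>x. f x + g x) (\<lambda>x v. f' x v + g' x v)"
  unfolding has_C1_deriv_def by (auto intro: has_derivative_add continuous_on_add)

lemma divergence_add:
  "has_C1_deriv f f' \<Longrightarrow> has_C1_deriv g g' \<Longrightarrow> divergence (\<lambda>x. f x + g x) x = divergence f x + divergence g x"
  using divergence_eq[OF has_C1_deriv_add] by (simp add: divergence_eq inner_add_left sum.distrib)

lemma
  assumes \<phi>: "has_C1_deriv \<phi> \<phi>'"
  shows has_C1_deriv_translate: "has_C1_deriv (\<lambda>x. \<phi> (x + y)) (\<lambda>x. \<phi>' (x + y))"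
    and divergence_translate: "divergence (\<lambda>x. \<phi> (x + y)) x = divergence \<phi> (x + y)"
proof -
  show *: "has_C1_deriv (\<lambda>x. \<phi> (x + y)) (\<lambda>x. \<phi>' (x + y))"
    unfolding has_C1_deriv_def
  proof (intro conjI allI)
    show "((\<lambda>x. \<phi> (x + y)) has_derivative \<phi>' (x + y)) (at x)" for x
      using has_derivative_compose[OF _ has_C1_derivD(1)[OF \<phi>], of "\<lambda>x. x + y" "\<lambda>v. v" x UNIV]
      by (simp add: has_derivative_add_const)
    show "continuous_on UNIV (\<lambda>x. \<phi>' (x + y) v)" for v
      by (rule continuous_on_compose2[OF has_C1_derivD(2)[OF \<phi>]]) (auto intro!: continuous_intros)
  qed
  show "divergence (\<lambda>x. \<phi> (x + y)) x = divergence \<phi> (x + y)"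
    by (simp add: divergence_eq[OF *] divergence_eq[OF \<phi>])
qed

lemma test_fields_translate:
  assumes "\<phi> \<in> test_fields"
  shows "(\<lambda>x. \<phi> (x + y)) \<in> test_fields"
proof (rule test_fieldsI[OF has_C1_deriv_translate[OF test_fieldsD(1)[OF assms]]])
  obtain R where R: "\<And>x. norm x > R \<Longrightarrow> \<phi> x = 0" using bounded_suppE[OF test_fieldsD(2)[OF assms]] by blast
  have "\<phi> (x + y) = 0" if "norm x > R + norm y" for x
    using norm_diff_ineq[of x y] that by (intro R) simp
  then show "bounded_supp (\<lambda>x. \<phi> (x + y))" by (rule bounded_suppI)
qed (rule test_fieldsD[OF assms])

text \<open>Chain and product rule for fields weighted by a function of \<open>g\<close>. The extra
  term in the divergence is the derivative of \<open>h \<circ> g\<close> in the direction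
  \<open>\<phi> x\<close>.\<close>

lemma
  fixes g :: "'a::euclidean_space \<Rightarrow> real"
  assumes h: "\<And>t. (h has_real_derivative h' t) (at t)" "continuous_on UNIV h'"
    and g: "has_C1_deriv g g'" and \<phi>: "has_C1_deriv \<phi> \<phi>'"
  shows has_C1_deriv_compose_scaleR: "has_C1_deriv (\<lambda>x. h (g x) *\<^sub>R \<phi> x)
      (\<lambda>x v. h (g x) *\<^sub>R \<phi>' x v + (h' (g x) * g' x v) *\<^sub>R \<phi> x)"
    and divergence_compose_scaleR:
      "divergence (\<lambda>x. h (g x) *\<^sub>R \<phi> x) x = h (g x) * divergence \<phi> x + h' (g x) * g' x (\<phi> x)"
proof -
  have ch: "continuous_on UNIV h"
    using h(1) DERIV_isCont by (auto intro!: continuous_at_imp_continuous_on)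
  note [continuous_intros] = has_C1_derivD(2,4)[OF g] has_C1_derivD(2,4)[OF \<phi>]
    continuous_on_compose2[OF ch] continuous_on_compose2[OF h(2)]
  show C1: "has_C1_deriv (\<lambda>x. h (g x) *\<^sub>R \<phi> x)
      (\<lambda>x v. h (g x) *\<^sub>R \<phi>' x v + (h' (g x) * g' x v) *\<^sub>R \<phi> x)"
    unfolding has_C1_deriv_def
  proof (intro conjI allI)
    fix x
    have "((\<lambda>x. h (g x)) has_derivative (\<lambda>v. h' (g x) * g' x v)) (at x)"
      using has_derivative_compose[OF has_C1_derivD(1)[OF g] h(1)[unfolded has_field_derivative_def]] .
    from has_derivative_scaleR[OF this has_C1_derivD(1)[OF \<phi>]]
    show "((\<lambda>x. h (g x) *\<^sub>R \<phi> x) has_derivative (\<lambda>v. h (g x) *\<^sub>R \<phi>' x v + (h' (g x) * g' x v) *\<^sub>R \<phi> x)) (at x)" .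
  qed (auto intro!: continuous_intros)
  have "g' x (\<phi> x) = (\<Sum>b\<in>Basis. g' x b * (\<phi> x \<bullet> b))"
  proof -
    interpret linear "g' x" by (rule has_C1_derivD[OF g])
    have "g' x (\<phi> x) = g' x (\<Sum>b\<in>Basis. (\<phi> x \<bullet> b) *\<^sub>R b)" by (simp add: euclidean_representation)
    then show ?thesis by (simp add: sum scale mult.commute)
  qed
  then show "divergence (\<lambda>x. h (g x) *\<^sub>R \<phi> x) x = h (g x) * divergence \<phi> x + h' (g x) * g' x (\<phi> x)"
    unfolding divergence_eq[OF C1] divergence_eq[OF \<phi>]
    by (simp add: inner_add_left sum.distrib sum_distrib_left mult.assoc)
qed

text \<open>With \<open>S t = sqrt (t\<^sup>2 + \<delta>\<^sup>2)\<close> in place of \<open>\<bar>t\<bar>\<close>, the test field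
  \<open>\<theta> = (1 + g / S g) / 2 \<cdot> \<phi> + (g / S g - 1) / 2 \<cdot> \<psi>\<close> interpolates between \<open>\<phi>\<close> where \<open>g > 0\<close> and \<open>-\<psi>\<close> where
  \<open>g < 0\<close>, and \<open>g div \<theta>\<close> differs from the integrand below by a divergence.\<close>

lemma smooth_pos_neg_part_bound:
  fixes g :: "'a::euclidean_space \<Rightarrow> real"
  assumes g: "has_C1_deriv g g'"
    and T: "\<And>\<theta>. \<theta> \<in> test_fields \<Longrightarrow> (LINT x|lborel. g x * divergence \<theta> x) \<le> T"
    and test: "\<phi> \<in> test_fields" "\<psi> \<in> test_fields" and "\<delta> > 0"
  shows "(LINT x|lborel. g x * ((divergence \<phi> x - divergence \<psi> x) / 2)
      + sqrt ((g x)\<^sup>2 + \<delta>\<^sup>2) * ((divergence \<phi> x + divergence \<psi> x) / 2)) \<le> T"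
proof -
  define S where "S t = sqrt (t\<^sup>2 + \<delta>\<^sup>2)" for t
  have S: "S t > 0" "\<bar>t\<bar> < S t" "S t * S t = t\<^sup>2 + \<delta>\<^sup>2" for t
  proof -
    show "S t > 0" using \<open>\<delta> > 0\<close> by (auto simp: S_def intro!: add_nonneg_pos)
    show "\<bar>t\<bar> < S t" using \<open>\<delta> > 0\<close> unfolding S_def by (intro real_less_rsqrt) simp
    show "S t * S t = t\<^sup>2 + \<delta>\<^sup>2" by (simp add: S_def)
  qed
  have dS: "(S has_real_derivative t / S t) (at t)" for t
  proof -
    have "t\<^sup>2 + \<delta>\<^sup>2 > 0" using \<open>\<delta> > 0\<close> by (intro add_nonneg_pos) auto
    then show ?thesis unfolding S_def by (auto intro!: derivative_eq_intros simp: divide_simps)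
  qed
  have cS: "continuous_on UNIV S" unfolding S_def by (intro continuous_intros)
  note [derivative_intros] = DERIV_chain2[OF dS]
  note [continuous_intros] = continuous_on_compose2[OF cS]
  have Snz: "S t \<noteq> 0" for t using S(1)[of t] by simp
  \<comment> \<open>The two weights in \<open>\<theta>\<close> differ by the constant 1, so they
    share this derivative; it comes from
    \<open>S t - t\<^sup>2 / S t = \<delta>\<^sup>2 / S t\<close>.\<close>
  let ?h' = "\<lambda>t. \<delta>\<^sup>2 / (2 * S t ^ 3)"
  have h': "(1 * S t - t * (t / S t)) / (S t * S t) / 2 = ?h' t" for t
    using S(1)[of t] S(3)[of t] by (simp add: field_simps power2_eq_square power3_eq_cube)
  have quot: "((\<lambda>t. t / S t) has_real_derivative (1 * S t - t * (t / S t)) / (S t * S t)) (at t)" for t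
    by (intro DERIV_divide DERIV_ident dS Snz)
  have h1: "((\<lambda>t. (1 + t / S t) / 2) has_real_derivative ?h' t) (at t)" for t
    by (rule DERIV_cong[OF _ h']) (rule DERIV_cdivide, use DERIV_add[OF DERIV_const[of 1] quot] in simp)
  have h2: "((\<lambda>t. (t / S t - 1) / 2) has_real_derivative ?h' t) (at t)" for t
    by (rule DERIV_cong[OF _ h']) (rule DERIV_cdivide, use DERIV_diff[OF quot DERIV_const[of 1]] in simp)
  have k: "((\<lambda>t. 1 / (2 * S t)) has_real_derivative - (t / (2 * S t ^ 3))) (at t)" for t
    by (rule derivative_eq_intros dS refl | use Snz[of t] in \<open>simp add: field_simps power3_eq_cube\<close>)+
  have ch': "continuous_on UNIV ?h'" "continuous_on UNIV (\<lambda>t. - (t / (2 * S t ^ 3)))"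
    by (auto intro!: continuous_intros cS simp: Snz)
  note \<phi> = test_fieldsD[OF test(1)] note \<psi> = test_fieldsD[OF test(2)]
  note \<phi>h = has_C1_deriv_compose_scaleR[OF h1 ch'(1) g \<phi>(1)] note \<psi>h = has_C1_deriv_compose_scaleR[OF h2 ch'(1) g \<psi>(1)]
  note \<phi>k = has_C1_deriv_compose_scaleR[OF k ch'(2) g \<phi>(1)] note \<psi>k = has_C1_deriv_compose_scaleR[OF k ch'(2) g \<psi>(1)]
  define \<theta> where "\<theta> = (\<lambda>x. ((1 + g x / S (g x)) / 2) *\<^sub>R \<phi> x + ((g x / S (g x) - 1) / 2) *\<^sub>R \<psi> x)"
  \<comment> \<open>The correcting field. The gradient terms of
    \<open>g x * divergence \<theta> x\<close> and \<open>\<delta>\<^sup>2 * divergence F x\<close>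
    cancel, while in the coefficient of
    \<open>(divergence \<phi> x + divergence \<psi> x) / 2\<close> the terms
    \<open>t\<^sup>2 / S t\<close> and \<open>\<delta>\<^sup>2 / S t\<close>, with
    \<open>t = g x\<close>, combine to \<open>S t\<close>.\<close>
  define F where "F = (\<lambda>x. (1 / (2 * S (g x))) *\<^sub>R \<phi> x + (1 / (2 * S (g x))) *\<^sub>R \<psi> x)"
  have C1: "has_C1_deriv \<theta> (\<lambda>x. frechet_derivative \<theta> (at x))" "has_C1_deriv F (\<lambda>x. frechet_derivative F (at x))"
    using C1_frechet[OF has_C1_deriv_add[OF \<phi>h \<psi>h]] C1_frechet[OF has_C1_deriv_add[OF \<phi>k \<psi>k]]
    unfolding \<theta>_def F_def by simp_all
  have supp: "bounded_supp \<theta>" "bounded_supp F"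
    unfolding \<theta>_def F_def by (intro bounded_supp_add bounded_supp_scaleR \<phi>(2) \<psi>(2))+
  have "\<theta> \<in> test_fields"
  proof (rule test_fieldsI[OF C1(1) supp(1)])
    fix x
    let ?s = "g x / S (g x)"
    \<comment> \<open>This makes \<open>\<theta> x\<close> a convex combination of
      \<open>\<phi> x\<close> and \<open>- \<psi> x\<close>, so the norm bound is inherited.\<close>
    have s: "\<bar>?s\<bar> \<le> 1" using S(1,2)[of "g x"] by (simp add: divide_le_eq)
    have "norm (\<theta> x) \<le> \<bar>(1 + ?s) / 2\<bar> * norm (\<phi> x) + \<bar>(?s - 1) / 2\<bar> * norm (\<psi> x)"
      unfolding \<theta>_def by (rule norm_triangle_le) simp
    also have "\<dots> \<le> \<bar>(1 + ?s) / 2\<bar> * 1 + \<bar>(?s - 1) / 2\<bar> * 1"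
      by (intro add_mono mult_left_mono \<phi>(3) \<psi>(3)) auto
    also have "\<dots> = 1" using s by (auto simp: abs_if field_simps)
    finally show "norm (\<theta> x) \<le> 1" .
  qed
  have cg: "continuous_on UNIV g" by (rule has_C1_derivD[OF g])
  have i1: "integrable lborel (\<lambda>x. g x * divergence \<theta> x)"
    by (intro continuous_bounded_supp_integrable continuous_on_mult cg bounded_supp_mult
        continuous_on_divergence[OF C1(1) supp(1)] bounded_supp_divergence[OF C1(1) supp(1)])
  have i2: "integrable lborel (divergence F)"
    by (intro continuous_bounded_supp_integrable continuous_on_divergence[OF C1(2) supp(2)] bounded_supp_divergence[OF C1(2) supp(2)])
  have "g x * ((divergence \<phi> x - divergence \<psi> x) / 2) + S (g x) * ((divergence \<phi> x + divergence \<psi> x) / 2)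
      = g x * divergence \<theta> x + \<delta>\<^sup>2 * divergence F x" for x
  proof -
    let ?p = "divergence \<phi> x" and ?q = "divergence \<psi> x" and ?t = "g x" and ?z = "S (g x)"
    let ?d = "g' x (\<phi> x) + g' x (\<psi> x)"
    have 1: "divergence \<theta> x = (1 + ?t / ?z) / 2 * ?p + (?t / ?z - 1) / 2 * ?q + \<delta>\<^sup>2 / (2 * ?z ^ 3) * ?d"
      unfolding \<theta>_def divergence_add[OF \<phi>h \<psi>h] divergence_compose_scaleR[OF h1 ch'(1) g \<phi>(1)]
        divergence_compose_scaleR[OF h2 ch'(1) g \<psi>(1)] by (simp add: algebra_simps add_divide_distrib diff_divide_distrib)
    have 2: "divergence F x = 1 / (2 * ?z) * (?p + ?q) - ?t / (2 * ?z ^ 3) * ?d"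
      unfolding F_def divergence_add[OF \<phi>k \<psi>k] divergence_compose_scaleR[OF k ch'(2) g \<phi>(1)]
        divergence_compose_scaleR[OF k ch'(2) g \<psi>(1)] by (simp add: algebra_simps add_divide_distrib diff_divide_distrib)
    have "?t * divergence \<theta> x + \<delta>\<^sup>2 * divergence F x = ?t * ((?p - ?q) / 2) + (?t\<^sup>2 + \<delta>\<^sup>2) / ?z * ((?p + ?q) / 2)"
      unfolding 1 2 using Snz[of ?t] by (simp add: field_simps power2_eq_square)
    also have "(?t\<^sup>2 + \<delta>\<^sup>2) / ?z = ?z" using S(3)[of ?t] Snz[of ?t] by (simp add: field_simps)
    finally show ?thesis by simp
  qed
  then have "(LINT x|lborel. g x * ((divergence \<phi> x - divergence \<psi> x) / 2)
      + S (g x) * ((divergence \<phi> x + divergence \<psi> x) / 2)) = (LINT x|lborel. g x * divergence \<theta> x)"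
    using i1 i2 integral_divergence_eq_0[OF C1(2) supp(2)] by simp
  also have "\<dots> \<le> T" by (rule T) fact
  finally show ?thesis by (simp add: S_def)
qed

subsection \<open>Total variation of positive and negative parts\<close>

text \<open>The positive and negative parts are \<open>(\<bar>w\<bar> + w) / 2\<close> and
  \<open>(\<bar>w\<bar> - w) / 2\<close>, so the left side is the integral \<open>?I\<close> below.
  For a mollification and a smoothed modulus in place of \<open>w\<close> and
  \<open>\<bar>w\<bar>\<close> the bound is known, and the error is a constant times
  \<open>e\<close>.\<close>

lemma pos_neg_part_bound:
  fixes w :: "'a::euclidean_space \<Rightarrow> real"
  assumes w: "integrable lborel w"
    and T: "\<And>\<theta>. \<theta> \<in> test_fields \<Longrightarrow> (LINT x|lborel. w x * divergence \<theta> x) \<le> T"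
    and test: "\<phi> \<in> test_fields" "\<psi> \<in> test_fields"
  shows "(LINT x|lborel. max 0 (w x) * divergence \<phi> x) + (LINT x|lborel. max 0 (- w x) * divergence \<psi> x) \<le> T"
proof -
  let ?p = "divergence \<phi>" and ?q = "divergence \<psi>"
  have c: "continuous_on UNIV ?p" "continuous_on UNIV ?q"
    and s: "bounded_supp ?p" "bounded_supp ?q"
    using test test_fieldsD continuous_on_divergence bounded_supp_divergence by metis+
  obtain B where B: "B > 0" "\<And>x. norm (?p x) \<le> B" using continuous_bounded_supp_bound[OF c(1) s(1)] by blast
  obtain C where C: "C > 0" "\<And>x. norm (?q x) \<le> C" using continuous_bounded_supp_bound[OF c(2) s(2)] by blast
  define N where "N = (LINT x|lborel. \<bar>?p x\<bar> + \<bar>?q x\<bar>)"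
  have N: "N \<ge> 0" unfolding N_def by (intro integral_nonneg_AE) auto
  note ip = continuous_bounded_supp_integrable[OF c(1) s(1)] continuous_bounded_supp_integrable[OF c(2) s(2)]
  have mult: "integrable lborel (\<lambda>x. f x * ?p x)" "integrable lborel (\<lambda>x. f x * ?q x)"
    if "integrable lborel f" for f
    using that c s by (auto intro!: integrable_mult_continuous_bounded_supp)
  let ?I = "LINT x|lborel. w x * ((?p x - ?q x) / 2) + \<bar>w x\<bar> * ((?p x + ?q x) / 2)"
  have intI: "integrable lborel (\<lambda>x. w x * ((?p x - ?q x) / 2) + \<bar>w x\<bar> * ((?p x + ?q x) / 2))"
    using mult[OF w] mult[OF integrable_abs[OF w]] by (simp add: algebra_simps add_divide_distrib diff_divide_distrib)
  have bound: "?I \<le> T + e * (B + C + N)" if "e > 0" for e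
  proof -
    obtain g g' where g: "has_C1_deriv g g'" "integrable lborel g" "(LINT x|lborel. \<bar>g x - w x\<bar>) < e"
      and gp: "\<And>p T. \<lbrakk>continuous_on UNIV p; bounded_supp p; \<And>y. (LINT x|lborel. w x * p (x + y)) \<le> T\<rbrakk> \<Longrightarrow>
       (LINT x|lborel. g x * p x) \<le> T"
      using mollification[OF w \<open>e > 0\<close>] by blast
    have gT: "(LINT x|lborel. g x * divergence \<theta> x) \<le> T" if "\<theta> \<in> test_fields" for \<theta>
    proof (rule gp)
      note \<theta> = test_fieldsD[OF that]
      show "continuous_on UNIV (divergence \<theta>)" by (rule continuous_on_divergence[OF \<theta>(1,2)])
      show "bounded_supp (divergence \<theta>)" by (rule bounded_supp_divergence[OF \<theta>(1,2)])
      show "(LINT x|lborel. w x * divergence \<theta> (x + y)) \<le> T" for y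
        using T[OF test_fields_translate[OF that, of y]] by (simp add: divergence_translate[OF \<theta>(1)])
    qed
    \<comment> \<open>The accuracy \<open>e\<close> of the mollification also serves as the
      smoothing parameter of the modulus.\<close>
    let ?S = "\<lambda>x. sqrt ((g x)\<^sup>2 + e\<^sup>2)"
    have cS: "continuous_on UNIV ?S" by (intro continuous_intros has_C1_derivD[OF g(1)])
    have "integrable lborel (\<lambda>x. ?S x * ((?p x + ?q x) / 2))"
    proof (rule continuous_bounded_supp_integrable)
      show "continuous_on UNIV (\<lambda>x. ?S x * ((?p x + ?q x) / 2))"
        by (intro continuous_on_mult continuous_on_divide continuous_on_add cS c continuous_on_const) simp
      show "bounded_supp (\<lambda>x. ?S x * ((?p x + ?q x) / 2))"
        using bounded_supp_mult[OF bounded_supp_add[OF s], of "\<lambda>x. ?S x / 2"] by simp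
    qed
    moreover have "integrable lborel (\<lambda>x. g x * ((?p x - ?q x) / 2))"
      using mult[OF g(2)] by (simp add: algebra_simps diff_divide_distrib)
    ultimately have intg: "integrable lborel (\<lambda>x. g x * ((?p x - ?q x) / 2) + ?S x * ((?p x + ?q x) / 2))"
      by (rule Bochner_Integration.integrable_add[rotated])
    define G where "G x = g x * ((?p x - ?q x) / 2) + ?S x * ((?p x + ?q x) / 2)" for x
    have intG: "integrable lborel G" using intg by (simp add: G_def[abs_def])
    have "?I \<le> (LINT x|lborel. G x + (\<bar>g x - w x\<bar> * (B + C) + e * (\<bar>?p x\<bar> + \<bar>?q x\<bar>)))"
    proof (rule integral_mono[OF intI])
      show "integrable lborel (\<lambda>x. G x + (\<bar>g x - w x\<bar> * (B + C) + e * (\<bar>?p x\<bar> + \<bar>?q x\<bar>)))"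
        using intG g(2) w ip by simp
      fix x
      \<comment> \<open>Bounding \<open>a\<close> and \<open>b\<close> by half of
        \<open>B + C\<close> makes the two errors containing \<open>D\<close> add up to
        \<open>D * (B + C)\<close>. The error from smoothing is bounded through \<open>P\<close>
        instead, since a constant would not be integrable.\<close>
      define a b D P where "a = (?p x - ?q x) / 2" and "b = (?p x + ?q x) / 2"
        and "D = \<bar>g x - w x\<bar>" and "P = \<bar>?p x\<bar> + \<bar>?q x\<bar>"
      have "P \<le> B + C" using B(2)[of x] C(2)[of x] by (simp add: P_def)
      moreover have "2 * \<bar>a\<bar> \<le> P" "2 * \<bar>b\<bar> \<le> P"
        by (simp_all add: a_def b_def P_def abs_triangle_ineq abs_triangle_ineq4)
      ultimately have ab: "\<bar>a\<bar> \<le> (B + C) / 2 \<and> \<bar>b\<bar> \<le> (B + C) / 2 \<and> \<bar>b\<bar> \<le> P" by auto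
      have "\<bar>g x\<bar> \<le> ?S x" by (rule real_le_rsqrt) simp
      moreover have "?S x \<le> \<bar>g x\<bar> + e"
        using sqrt_sum_squares_le_sum_abs[of "g x" e] \<open>e > 0\<close> by simp
      ultimately have S: "\<bar>\<bar>w x\<bar> - ?S x\<bar> \<le> D + e" unfolding D_def by linarith
      have "(w x - g x) * a \<le> D * \<bar>a\<bar>"
        unfolding D_def by (metis abs_ge_self abs_minus_commute abs_mult)
      also have "\<dots> \<le> D * ((B + C) / 2)" by (rule mult_left_mono[OF ab[THEN conjunct1]]) (simp add: D_def)
      finally have 1: "(w x - g x) * a \<le> D * ((B + C) / 2)" .
      have "(\<bar>w x\<bar> - ?S x) * b \<le> \<bar>\<bar>w x\<bar> - ?S x\<bar> * \<bar>b\<bar>" by (metis abs_ge_self abs_mult)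
      also have "\<dots> \<le> (D + e) * \<bar>b\<bar>" by (rule mult_right_mono[OF S]) simp
      also have "\<dots> \<le> D * ((B + C) / 2) + e * P"
        unfolding distrib_right using \<open>e > 0\<close> by (intro add_mono mult_left_mono) (use ab \<open>e > 0\<close> in \<open>auto simp: D_def\<close>)
      finally have 2: "(\<bar>w x\<bar> - ?S x) * b \<le> D * ((B + C) / 2) + e * P" .
      have "w x * a + \<bar>w x\<bar> * b = g x * a + ?S x * b + ((w x - g x) * a + (\<bar>w x\<bar> - ?S x) * b)"
        by (simp add: algebra_simps)
      also have "\<dots> \<le> g x * a + ?S x * b + (D * ((B + C) / 2) + (D * ((B + C) / 2) + e * P))"
        by (intro add_mono order_refl 1 2)
      also have "\<dots> = g x * a + ?S x * b + (D * (B + C) + e * P)" by (simp add: field_simps)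
      finally show "w x * ((?p x - ?q x) / 2) + \<bar>w x\<bar> * ((?p x + ?q x) / 2) \<le>
          G x + (\<bar>g x - w x\<bar> * (B + C) + e * (\<bar>?p x\<bar> + \<bar>?q x\<bar>))"
        unfolding G_def a_def b_def D_def P_def .
    qed
    also have "\<dots> = (LINT x|lborel. G x) + ((LINT x|lborel. \<bar>g x - w x\<bar>) * (B + C) + e * N)"
    proof -
      have "integrable lborel (\<lambda>x. \<bar>g x - w x\<bar> * (B + C))" "integrable lborel (\<lambda>x. e * (\<bar>?p x\<bar> + \<bar>?q x\<bar>))"
        using g(2) w ip by simp_all
      then show ?thesis
        using intG by (simp only: Bochner_Integration.integral_add Bochner_Integration.integrable_add
            integral_mult_left_zero integral_mult_right_zero N_def)
    qed
    also have "\<dots> \<le> T + (e * (B + C) + e * N)"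
      using smooth_pos_neg_part_bound[OF g(1) gT test \<open>e > 0\<close>] g(3) B(1) C(1) N
      by (intro add_mono mult_right_mono) (auto simp: G_def)
    finally show ?thesis by (simp add: algebra_simps)
  qed
  have "?I \<le> T"
  proof (rule field_le_epsilon)
    fix d :: real assume "d > 0"
    have pos: "B + C + N > 0" using B(1) C(1) N by simp
    then show "?I \<le> T + d" using bound[of "d / (B + C + N)"] \<open>d > 0\<close> by simp
  qed
  moreover have "?I = (LINT x|lborel. max 0 (w x) * ?p x + max 0 (- w x) * ?q x)"
    by (intro Bochner_Integration.integral_cong) (auto simp: max_def field_simps)
  moreover have "\<dots> = (LINT x|lborel. max 0 (w x) * ?p x) + (LINT x|lborel. max 0 (- w x) * ?q x)"
    using w by (intro Bochner_Integration.integral_add mult) auto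
  ultimately show ?thesis by simp
qed

lemma zero_test_field: "(\<lambda>x. 0) \<in> test_fields"
  by (rule test_fieldsI[of _ "\<lambda>x v. 0"]) (auto simp: has_C1_deriv_def bounded_supp_def)

text \<open>For \<open>T \<ge> 0\<close> the truncation of negative integrals by
  \<open>ennreal\<close> has no effect on the comparison.\<close>

lemma TV_le_iff:
  fixes u :: "'a::euclidean_space \<Rightarrow> real"
  assumes "T \<ge> 0"
  shows "TV u \<le> ennreal T \<longleftrightarrow> (\<forall>\<phi>\<in>test_fields. (LINT x|lebesgue. u x * divergence \<phi> x) \<le> T)"
  unfolding TV_def SUP_le_iff using assms by (simp add: ennreal_le_iff)

text \<open>The bridge from \<open>lebesgue\<close> to \<open>lborel\<close>: a Lebesgue measurable
  function is exchanged for a Borel representative, to which translations and product measures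
  apply.\<close>

lemma integral_lebesgue_mult_divergence:
  fixes u u' :: "'a::euclidean_space \<Rightarrow> real"
  assumes "u' \<in> borel_measurable borel" "AE x in lebesgue. u x = u' x" "u \<in> borel_measurable lebesgue"
    and "\<phi> \<in> test_fields"
  shows "(LINT x|lebesgue. u x * divergence \<phi> x) = (LINT x|lborel. u' x * divergence \<phi> x)"
proof -
  have [measurable]: "divergence \<phi> \<in> borel_measurable borel"
    using continuous_on_divergence[OF test_fieldsD(1,2)[OF assms(4)]] by (rule borel_measurable_continuous_onI)
  have [measurable]: "divergence \<phi> \<in> borel_measurable lebesgue" "u' \<in> borel_measurable lebesgue"
    using assms(1) by (auto intro: measurable_completion)
  note [measurable] = assms(1,3)
  have "(LINT x|lebesgue. u x * divergence \<phi> x) = (LINT x|lebesgue. u' x * divergence \<phi> x)"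
    by (rule integral_cong_AE) (use assms(2) in auto)
  also have "\<dots> = (LINT x|lborel. u' x * divergence \<phi> x)" by (rule integral_completion) measurable
  finally show ?thesis .
qed

text \<open>The bound \<open>T\<close> holds for every pair of independently chosen test fields, so
  the suprema over the two fields can be taken one after the other.\<close>

lemma TV_pos_neg_part:
  fixes w :: "'a::euclidean_space \<Rightarrow> real"
  assumes w: "integrable lebesgue w"
  shows "TV (\<lambda>x. max 0 (w x)) + TV (\<lambda>x. max 0 (- w x)) \<le> TV w"
proof (cases "TV w = \<infinity>")
  case False
  then obtain T where T: "T \<ge> 0" "TV w = ennreal T" by (cases "TV w") auto
  have meas: "w \<in> borel_measurable lebesgue" using w by auto
  then obtain w' where w': "w' \<in> borel_measurable borel" "AE x in lborel. w x = w' x"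
    using completion_ex_borel_measurable_real[of w lborel] by auto
  note ae = AE_completion[OF w'(2)]
  have [measurable]: "w \<in> borel_measurable lebesgue" "w' \<in> borel_measurable borel" "w' \<in> borel_measurable lebesgue"
    using meas w'(1) by (auto intro: measurable_completion)
  have "integrable lebesgue w'"
    using w ae by (subst integrable_cong_AE[of _ _ w]) auto
  then have int: "integrable lborel w'" using integrable_completion[of w' lborel] w'(1) by simp
  let ?P = "\<lambda>\<phi>. LINT x|lebesgue. max 0 (w x) * divergence \<phi> x"
  let ?N = "\<lambda>\<phi>. LINT x|lebesgue. max 0 (- w x) * divergence \<phi> x"
  have le: "?P \<phi> + ?N \<psi> \<le> T" if "\<phi> \<in> test_fields" "\<psi> \<in> test_fields" for \<phi> \<psi>
  proof -
    have "?P \<phi> = (LINT x|lborel. max 0 (w' x) * divergence \<phi> x)"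
      by (rule integral_lebesgue_mult_divergence) (use ae that in auto)
    moreover have "?N \<psi> = (LINT x|lborel. max 0 (- w' x) * divergence \<psi> x)"
      by (rule integral_lebesgue_mult_divergence) (use ae that in auto)
    moreover have "(LINT x|lborel. w' x * divergence \<theta> x) \<le> T" if "\<theta> \<in> test_fields" for \<theta>
      using TV_le_iff[OF T(1), of w] T(2) that integral_lebesgue_mult_divergence[OF w'(1) ae meas that] by auto
    ultimately show ?thesis using pos_neg_part_bound[OF int _ that] by simp
  qed
  \<comment> \<open>Testing with the zero field bounds each integral separately by \<open>T\<close>.
    This covers the cases in which the other integral is negative and becomes 0 under
    \<open>ennreal\<close>.\<close>
  have P0: "?P (\<lambda>x. 0) = 0" and N0: "?N (\<lambda>x. 0) = 0"
    by (simp_all add: divergence_eq[of _ "\<lambda>x v. 0"] has_C1_deriv_def)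
  have "ennreal (?P \<phi>) + ennreal (?N \<psi>) \<le> ennreal T" if "\<phi> \<in> test_fields" "\<psi> \<in> test_fields" for \<phi> \<psi>
  proof -
    have "ennreal (?P \<phi>) + ennreal (?N \<psi>) = ennreal (max 0 (?P \<phi>) + max 0 (?N \<psi>))"
      by (simp add: ennreal_plus max_def ennreal_neg)
    also have "\<dots> \<le> ennreal T"
      using le[OF that] le[OF zero_test_field that(2)] le[OF that(1) zero_test_field] P0 N0 T(1)
      by (intro ennreal_leI) (simp add: max_def)
    finally show ?thesis .
  qed
  then have "TV (\<lambda>x. max 0 (w x)) + ennreal (?N \<psi>) \<le> ennreal T" if "\<psi> \<in> test_fields" for \<psi>
    unfolding TV_def using zero_test_field that
    by (subst ennreal_SUP_add_left[symmetric]) (auto intro!: SUP_least)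
  then show ?thesis
    unfolding T(2) TV_def[of "\<lambda>x. max 0 (- w x)"] using zero_test_field
    by (subst ennreal_SUP_add_right) (auto intro!: SUP_least)
qed simp

text \<open>Test fields are closed under negation, so \<open>v\<close> is tested with
  \<open>- \<phi>\<close> while \<open>u\<close> is tested with \<open>\<phi>\<close>.\<close>

lemma TV_diff_le:
  fixes u v :: "'a::euclidean_space \<Rightarrow> real"
  assumes "integrable lebesgue u" "integrable lebesgue v"
  shows "TV (\<lambda>x. u x - v x) \<le> TV u + TV v"
proof (cases "TV u = \<infinity> \<or> TV v = \<infinity>")
  case False
  then obtain S T where ST: "S \<ge> 0" "TV u = ennreal S" "T \<ge> 0" "TV v = ennreal T"
    by (cases "TV u"; cases "TV v") auto
  have "(LINT x|lebesgue. (u x - v x) * divergence \<phi> x) \<le> S + T" if \<phi>: "\<phi> \<in> test_fields" for \<phi>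
  proof -
    note d = test_fieldsD[OF \<phi>]
    have C1: "has_C1_deriv (\<lambda>x. - \<phi> x) (\<lambda>x v. - frechet_derivative \<phi> (at x) v)"
      using d(1) unfolding has_C1_deriv_def by (auto intro!: has_derivative_minus continuous_on_minus)
    have "(\<lambda>x. - \<phi> x) \<in> test_fields"
      by (rule test_fieldsI[OF C1]) (use d in \<open>auto simp: bounded_supp_def\<close>)
    moreover have "divergence (\<lambda>x. - \<phi> x) x = - divergence \<phi> x" for x
      by (simp add: divergence_eq[OF C1] divergence_eq[OF d(1)] sum_negf)
    ultimately have "(LINT x|lebesgue. u x * divergence \<phi> x) \<le> S" "(LINT x|lebesgue. v x * - divergence \<phi> x) \<le> T"
      using TV_le_iff[OF ST(1), of u] TV_le_iff[OF ST(3), of v] ST \<phi> by (auto dest!: bspec)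
    moreover have "integrable lebesgue (\<lambda>x. u x * divergence \<phi> x)" "integrable lebesgue (\<lambda>x. v x * divergence \<phi> x)"
      using assms d by (auto intro!: integrable_mult_continuous_bounded_supp continuous_on_divergence bounded_supp_divergence)
    ultimately show ?thesis by (simp add: left_diff_distrib)
  qed
  then show ?thesis using ST by (simp add: TV_le_iff ennreal_plus[symmetric] del: ennreal_plus)
qed auto

section \<open>From total variation to perimeter\<close>

lemma Per_finite_imp_integrable: "Per E < \<infinity> \<Longrightarrow> integrable lebesgue (indicat_real E)"
  unfolding Per_def BV_def by (auto split: if_splits)

lemma Per_eq_TV: "integrable lebesgue (indicat_real E) \<Longrightarrow> Per E = TV (indicat_real E)"
  unfolding Per_def BV_def by (simp add: not_less top_unique)

text \<open>Equivalent to submodularity of the perimeter, applied to \<open>A\<close> and the complement of \<open>B\<close>.\<close>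

lemma Per_diff_add_Per_diff_le:
  fixes A B :: "'a::euclidean_space set"
  shows "Per (A - B) + Per (B - A) \<le> Per A + Per B"
proof (cases "Per A < \<infinity> \<and> Per B < \<infinity>")
  case True
  then have i: "integrable lebesgue (indicat_real A)" "integrable lebesgue (indicat_real B)"
    by (auto intro: Per_finite_imp_integrable)
  let ?w = "\<lambda>x. indicat_real A x - indicat_real B x"
  have w: "integrable lebesgue ?w" using i by simp
  have AB: "indicat_real (A - B) = (\<lambda>x. max 0 (?w x))" "indicat_real (B - A) = (\<lambda>x. max 0 (- ?w x))"
    by (auto simp: indicator_def fun_eq_iff)
  then have "integrable lebesgue (indicat_real (A - B))" "integrable lebesgue (indicat_real (B - A))"
    using w Bochner_Integration.integrable_minus[OF w] by (auto intro!: integrable_max)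
  then have "Per (A - B) + Per (B - A) \<le> TV ?w"
    using TV_pos_neg_part[OF w] by (simp add: Per_eq_TV AB)
  also have "\<dots> \<le> Per A + Per B" using TV_diff_le[OF i] by (simp add: Per_eq_TV i)
  finally show ?thesis .
qed (auto simp: not_less top_unique)

subsection \<open>The Cheeger pair\<close>

text \<open>Lebesgue measure is complete, so a set contained in a null set is null; this covers
  arbitrary \<open>A\<close> and \<open>B\<close>. In the form on the right, inclusions can be
  combined pointwise.\<close>

lemma ae_subset_iff_AE: "A \<subseteq>\<^sub>0 B \<longleftrightarrow> (AE x in lebesgue. x \<in> A \<longrightarrow> x \<in> B)"
proof
  assume "A \<subseteq>\<^sub>0 B"
  then show "AE x in lebesgue. x \<in> A \<longrightarrow> x \<in> B"
    unfolding ae_subset_def by (rule AE_I'[where N="A - B"]) auto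
next
  assume "AE x in lebesgue. x \<in> A \<longrightarrow> x \<in> B"
  then obtain N where "N \<in> null_sets lebesgue" "{x. \<not> (x \<in> A \<longrightarrow> x \<in> B)} \<subseteq> N"
    unfolding eventually_ae_filter by auto
  then show "A \<subseteq>\<^sub>0 B"
    unfolding ae_subset_def by (intro null_sets_completion_subset[of "A - B" N]) auto
qed

lemma ae_subset_emeasure_le:
  assumes "A \<subseteq>\<^sub>0 B" "B \<in> sets lebesgue"
  shows "emeasure lebesgue A \<le> emeasure lebesgue B"
  by (rule emeasure_mono_AE) (use assms in \<open>simp_all only: ae_subset_iff_AE\<close>)

lemma ennreal_divide_mult_cancel:
  fixes a b :: ennreal
  assumes "b \<noteq> 0" "b \<noteq> \<infinity>"
  shows "a / b * b = a"
proof -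
  have "b / b = 1" using assms by (intro ennreal_divide_self) (auto simp: top.not_eq_extremum)
  then show ?thesis by (simp add: ennreal_divide_times)
qed

theorem theorem4p10:
  fixes \<Omega> \<Omega>\<^sub>s \<Omega>\<^sub>c \<Omega>\<^sub>1\<^sub>c :: "(real^2) set" and lambda\<^sub>c :: ennreal
  assumes "open \<Omega>" and "connected \<Omega>" and "\<Omega> \<noteq> {}" and "bounded \<Omega>" and "Per \<Omega> < \<infinity>"
    and "\<Omega>\<^sub>s \<in> sets lebesgue" and "\<Omega>\<^sub>s \<subseteq>\<^sub>0 \<Omega>" and "Per \<Omega>\<^sub>s < \<infinity>"
    and "emeasure lebesgue \<Omega>\<^sub>s > 0" and "emeasure lebesgue (\<Omega> - \<Omega>\<^sub>s) > 0"
    and "ae_maximal (is_cheeger_set (\<Omega> - \<Omega>\<^sub>s)) \<Omega>\<^sub>c"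
    and "lambda\<^sub>c = Per \<Omega>\<^sub>c / emeasure lebesgue \<Omega>\<^sub>c"
    and "ae_minimal
           (is_arg_min (\<lambda>E. Per E + lambda\<^sub>c * emeasure lebesgue E)
              (\<lambda>E. E \<in> sets lebesgue \<and> \<Omega>\<^sub>s \<subseteq>\<^sub>0 E \<and> E \<subseteq>\<^sub>0 \<Omega>)) \<Omega>\<^sub>1\<^sub>c"
  shows "is_arg_min S_functional (\<lambda>p. p \<in> admissible_pairs \<Omega> \<Omega>\<^sub>s) (\<Omega>\<^sub>1\<^sub>c, \<Omega>\<^sub>c)"
proof -
  let ?m = "emeasure lebesgue :: (real^2) set \<Rightarrow> ennreal"
  let ?A = "\<Omega>\<^sub>1\<^sub>c" and ?B = "\<Omega>\<^sub>c" and ?l = "lambda\<^sub>c"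
  have \<Omega>[measurable]: "\<Omega> \<in> sets lebesgue" using assms(1) by auto
  note \<Omega>s[measurable] = assms(6)
  have fin\<Omega>: "?m \<Omega> < \<infinity>" using bounded_set_imp_lmeasurable[OF assms(4) \<Omega>] by (simp add: fmeasurable_def)
  note [simp del] = emeasure_completion
  have cheeger: "is_cheeger_set (\<Omega> - \<Omega>\<^sub>s) ?B" using assms(11) by (simp add: ae_maximal_def)
  have B: "?B \<in> sets lebesgue" "?B \<subseteq>\<^sub>0 \<Omega> - \<Omega>\<^sub>s" "?m ?B > 0"
    using cheeger by (simp_all add: is_cheeger_set_def is_arg_min_linorder)
  have B_le: "?l \<le> Per E / ?m E" if "E \<in> sets lebesgue" "E \<subseteq>\<^sub>0 \<Omega> - \<Omega>\<^sub>s" "?m E > 0" for E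
    using cheeger that unfolding assms(12) by (simp add: is_cheeger_set_def is_arg_min_linorder cheeger_ratio_def)
  let ?P = "is_arg_min (\<lambda>E. Per E + ?l * ?m E) (\<lambda>E. E \<in> sets lebesgue \<and> \<Omega>\<^sub>s \<subseteq>\<^sub>0 E \<and> E \<subseteq>\<^sub>0 \<Omega>)"
  have A_min: "?P ?A" "\<And>E. ?P E \<Longrightarrow> E \<subseteq>\<^sub>0 ?A \<Longrightarrow> ?A \<subseteq>\<^sub>0 E"
    using assms(13) by (simp_all add: ae_minimal_def)
  then have A: "?A \<in> sets lebesgue" "\<Omega>\<^sub>s \<subseteq>\<^sub>0 ?A" "?A \<subseteq>\<^sub>0 \<Omega>"
    by (simp_all add: is_arg_min_linorder)
  have A_le: "Per ?A + ?l * ?m ?A \<le> Per E + ?l * ?m E"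
    if "E \<in> sets lebesgue" "\<Omega>\<^sub>s \<subseteq>\<^sub>0 E" "E \<subseteq>\<^sub>0 \<Omega>" for E
    using A_min(1) that by (simp add: is_arg_min_linorder)
  note [measurable] = A(1) B(1)
  have fin: "?m E < \<infinity>" if "E \<subseteq>\<^sub>0 \<Omega>" for E
    using ae_subset_emeasure_le[OF that \<Omega>] fin\<Omega> by (rule le_less_trans)
  have B\<Omega>: "?B \<subseteq>\<^sub>0 \<Omega>" using B(2) unfolding ae_subset_iff_AE by auto
  \<comment> \<open>Finiteness of the Cheeger constant: \<open>\<Omega> - \<Omega>\<^sub>s\<close>
    is a competitor of positive measure, and the inequality for differences bounds its perimeter by
    \<open>Per \<Omega> + Per \<Omega>\<^sub>s\<close>.\<close>
  have "Per (\<Omega> - \<Omega>\<^sub>s) + Per (\<Omega>\<^sub>s - \<Omega>) < \<infinity>"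
    using Per_diff_add_Per_diff_le[of \<Omega> \<Omega>\<^sub>s] assms(5,8) by (auto simp: less_top[symmetric] top_unique)
  then have "Per (\<Omega> - \<Omega>\<^sub>s) / ?m (\<Omega> - \<Omega>\<^sub>s) < \<infinity>"
    using assms(10) by (auto simp: ennreal_divide_eq_top_iff less_top[symmetric])
  then have l_fin: "?l < \<infinity>"
    using B_le[of "\<Omega> - \<Omega>\<^sub>s"] assms(10) by (auto simp: ae_subset_def)
  have lB: "?l * ?m ?B = Per ?B"
    unfolding assms(12) using B(3) fin[OF B\<Omega>] by (intro ennreal_divide_mult_cancel) auto
  have B_fin: "Per ?B < \<infinity>" unfolding lB[symmetric] using l_fin fin[OF B\<Omega>] by (simp add: ennreal_mult_less_top)
  \<comment> \<open>The product form of the Cheeger inequality extends to null sets, where the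
    quotient says nothing; \<open>?B - ?A\<close> may be one.\<close>
  have l_le: "?l * ?m E \<le> Per E" if E: "E \<in> sets lebesgue" "E \<subseteq>\<^sub>0 \<Omega> - \<Omega>\<^sub>s" for E
  proof (cases "?m E = 0")
    case False
    have "E \<subseteq>\<^sub>0 \<Omega>" using E(2) unfolding ae_subset_iff_AE by auto
    have "?l * ?m E \<le> Per E / ?m E * ?m E"
      using B_le[OF E] False by (intro mult_right_mono) (auto simp: zero_less_iff_neq_zero)
    also have "\<dots> = Per E" using False fin[OF \<open>E \<subseteq>\<^sub>0 \<Omega>\<close>] by (intro ennreal_divide_mult_cancel) auto
    finally show ?thesis .
  qed simp
  txt \<open>Removing the Cheeger set from \<open>\<Omega>\<^sub>1\<^sub>c\<close> does not increase the energy, so minimality forces disjointness.\<close>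
  have sub: "\<Omega>\<^sub>s \<subseteq>\<^sub>0 ?A - ?B" "?A - ?B \<subseteq>\<^sub>0 \<Omega>" "?B - ?A \<subseteq>\<^sub>0 \<Omega> - \<Omega>\<^sub>s"
    using A(2,3) B(2) unfolding ae_subset_iff_AE by (auto elim!: eventually_elim2)
  have "?m ?A = ?m (?A - ?B) + ?m (?A \<inter> ?B)" "?m ?B = ?m (?B - ?A) + ?m (?A \<inter> ?B)"
    by (subst plus_emeasure; (auto intro!: arg_cong[of _ _ ?m]))+
  note split = this
  \<comment> \<open>\<open>Per ?B\<close> is added on both sides because extended non-negative reals
    do not subtract well. On the left it equals \<open>?l * ?m ?B\<close>, which splits along
    \<open>?A\<close>: the part in \<open>?A\<close> completes \<open>?l * ?m ?A\<close>, and the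
    part outside is bounded by \<open>Per (?B - ?A)\<close>.\<close>
  have "Per (?A - ?B) + ?l * ?m (?A - ?B) + Per ?B \<le> Per ?A + ?l * ?m ?A + Per ?B"
  proof -
    have "Per (?A - ?B) + ?l * ?m (?A - ?B) + Per ?B
        = Per (?A - ?B) + ?l * ?m (?B - ?A) + (?l * ?m (?A - ?B) + ?l * ?m (?A \<inter> ?B))"
      unfolding lB[symmetric] split(2) by (simp add: distrib_left ac_simps)
    also have "\<dots> \<le> Per (?A - ?B) + Per (?B - ?A) + (?l * ?m (?A - ?B) + ?l * ?m (?A \<inter> ?B))"
      by (intro add_mono order_refl l_le sub) measurable
    also have "\<dots> \<le> Per ?A + Per ?B + (?l * ?m (?A - ?B) + ?l * ?m (?A \<inter> ?B))"
      by (intro add_mono order_refl Per_diff_add_Per_diff_le)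
    also have "\<dots> = Per ?A + ?l * ?m ?A + Per ?B"
      unfolding split(1) by (simp add: distrib_left ac_simps)
    finally show ?thesis .
  qed
  \<comment> \<open>Cancelling \<open>Per ?B\<close> is legitimate because it is finite.\<close>
  then have "Per (?A - ?B) + ?l * ?m (?A - ?B) \<le> Per ?A + ?l * ?m ?A"
    using B_fin by (metis ennreal_add_left_cancel_le add.commute less_irrefl)
  then have "?P (?A - ?B)"
    using sub A_le unfolding is_arg_min_linorder by (auto intro: order_trans)
  then have "?A \<subseteq>\<^sub>0 ?A - ?B"
    by (rule A_min(2)) (simp add: ae_subset_iff_AE)
  then have disj: "?m (?A \<inter> ?B) = 0"
    by (simp add: ae_subset_def Diff_Diff_Int null_setsD1)

  have adm: "(?A, ?B) \<in> admissible_pairs \<Omega> \<Omega>\<^sub>s"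
    using A B B\<Omega> disj by (simp add: admissible_pairs_def)
  have "S_functional (?A, ?B) \<le> S_functional (E, F)" if "(E, F) \<in> admissible_pairs \<Omega> \<Omega>\<^sub>s" for E F
  proof (cases "?m F = 0")
    case False
    have E: "E \<in> sets lebesgue" "E \<subseteq>\<^sub>0 \<Omega>" "\<Omega>\<^sub>s \<subseteq>\<^sub>0 E"
      and F: "F \<in> sets lebesgue" "F \<subseteq>\<^sub>0 \<Omega>" and EF: "?m (E \<inter> F) = 0"
      using that by (auto simp: admissible_pairs_def)
    \<comment> \<open>Almost every point of \<open>F\<close> lies outside \<open>E\<close>, hence
      outside \<open>\<Omega>\<^sub>s\<close>, so \<open>F\<close> competes in the Cheeger
      problem.\<close>
    have "AE x in lebesgue. x \<notin> E \<inter> F"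
      using EF E(1) F(1) by (intro AE_not_in) (auto simp: null_sets_def)
    then have F_sub: "F \<subseteq>\<^sub>0 \<Omega> - \<Omega>\<^sub>s"
      using E(3) F(2) unfolding ae_subset_iff_AE by eventually_elim auto
    \<comment> \<open>Regrouping \<open>?m ?A / ?m ?B * Per ?B\<close> puts the ratio of
      \<open>?B\<close>, that is \<open>?l\<close>, in front of \<open>?m ?A\<close>.\<close>
    have "S_functional (?A, ?B) = Per ?A + ?l * ?m ?A"
      using B(3) by (simp add: S_functional_def assms(12) ennreal_times_divide ennreal_divide_times mult.commute)
    also have "\<dots> \<le> Per E + ?l * ?m E" by (rule A_le[OF E(1,3,2)])
    also have "\<dots> \<le> Per E + Per F / ?m F * ?m E"
      using B_le[OF F(1) F_sub] False by (intro add_left_mono mult_right_mono) (auto simp: zero_less_iff_neq_zero)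
    also have "\<dots> = S_functional (E, F)"
      using False by (simp add: S_functional_def ennreal_times_divide ennreal_divide_times mult.commute)
    finally show ?thesis .
  qed (simp add: S_functional_def)
  then show ?thesis using adm unfolding is_arg_min_def by (auto simp: not_less)
qed

end
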